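(* Let $T>0$ be fixed and let $1\leqslant\theta<2$. Then the observability constant $C_T(\theta)$ in time $T$ of the problem $$u_{tt}-(x^\theta u_x)_x=0\ \text{ in }]0,T[\times]0,1[,\qquad u(t,1)=0,\quad \lim_{x\downarrow0}x^\theta u_x(t,x)=0\ \ (0<t<T),\qquad u(0,\cdot)=u_0,\ u_t(0,\cdot)=u_1,$$ satisfies $$C_T(\theta)\leqslant(2-\theta)T.$$
   Context: Here $a(x)=x^\theta$. Spaces: $H^1_a(0,1)$ is the space of $u\in L^2(0,1)$, locally absolutely continuous in $]0,1]$, with $x^{\theta/2}u'\in L^2(0,1)$ and $u(1)=0$; $H^2_a(0,1)=\{u\in H^1_a(0,1): x^\theta u'\in H^1(0,1)\}$ (for such $u$ and $\theta\in[1,2[$, automatically $\lim_{x\downarrow0}x^\theta u'(x)=0$). On the Hilbert space $H^1_a(0,1)\times L^2(0,1)$ with scalar product $\langle(u,v),(\tilde u,\tilde v)\rangle=\int_0^1(v\tilde v+x^\theta u'\tilde u')dx$, the operator $A(u,v)=(v,(x^\theta u')')$, $D(A)=H^2_a(0,1)\times H^1_a(0,1)$, generates a contraction semigroup; the mild solution with data $(u_0,u_1)\in H^1_a(0,1)\times L^2(0,1)$ is the first component of $e^{tA}(u_0,u_1)$, and it is classical if $(u_0,u_1)\in D(A)$. For mild solutions, $u_x(\cdot,1)\in L^2(0,T)$ is defined as the $L^2(0,T)$-limit of the traces $u^n_x(\cdot,1)$ of classical solutions $u^n$ with data converging to $(u_0,u_1)$. Energy: $E_u(t)=\frac12\int_0^1\{u_t^2(t,x)+x^\theta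 u_x^2(t,x)\}dx$. The observability constant $C_T(\theta)$ is $$C_T(\theta)=\inf_{(u_0,u_1)\neq(0,0)}\frac{\int_0^Tu_x^2(t,1)\,dt}{E_u(0)},$$ the infimum being over all $(u_0,u_1)\in H^1_a(0,1)\times L^2(0,1)$, with $u$ the corresponding mild solution. *)

theory Defs
  imports "HOL-Analysis.Analysis" "HOL-Library.Function_Algebras"
begin

instantiation "fun" :: (type, real_vector) real_vector
begin

definition scaleR_fun :: "real \<Rightarrow> ('a \<Rightarrow> 'b) \<Rightarrow> 'a \<Rightarrow> 'b"
  where "scaleR_fun c f = (\<lambda>x. c *\<^sub>R f x)"

instance
  by standard (simp_all add: scaleR_fun_def fun_eq_iff scaleR_add_right scaleR_add_left)

end


section \<open>Strongly continuous contraction semigroups and generators\<close>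

text \<open>
  Elements of \<open>L\<^sup>2\<close>-type spaces are represented by functions, not by classes of functions.  A
  Hilbert space is therefore given by a linear carrier \<open>C\<close> and a seminorm \<open>N\<close> on it, and equality of
  \<open>x\<close> and \<open>y\<close> in the space reads \<open>N (x - y) = 0\<close>.
\<close>

definition contraction_semigroup ::
    "'a::real_vector set \<Rightarrow> ('a \<Rightarrow> real) \<Rightarrow> (real \<Rightarrow> 'a \<Rightarrow> 'a) \<Rightarrow> bool" where
  "contraction_semigroup C N S \<longleftrightarrow>
     (\<forall>t\<ge>0. \<forall>x\<in>C. S t x \<in> C) \<and>
     (\<forall>t\<ge>0. \<forall>x\<in>C. \<forall>y\<in>C. \<forall>a b.
        N (S t (a *\<^sub>R x + b *\<^sub>R y) - (a *\<^sub>R S t x + b *\<^sub>R S t y)) = 0) \<and>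
     (\<forall>x\<in>C. N (S 0 x - x) = 0) \<and>
     (\<forall>s\<ge>0. \<forall>t\<ge>0. \<forall>x\<in>C. N (S (s + t) x - S s (S t x)) = 0) \<and>
     (\<forall>x\<in>C. ((\<lambda>t. N (S t x - x)) \<longlongrightarrow> 0) (at_right 0)) \<and>
     (\<forall>t\<ge>0. \<forall>x\<in>C. N (S t x) \<le> N x)"

definition semigroup_generator ::
    "'a::real_vector set \<Rightarrow> ('a \<Rightarrow> real) \<Rightarrow> (real \<Rightarrow> 'a \<Rightarrow> 'a) \<Rightarrow> ('a \<times> 'a) set" where
  "semigroup_generator C N S =
     {(x, y). x \<in> C \<and> y \<in> C \<and>
              ((\<lambda>h. N ((S h x - x) /\<^sub>R h - y)) \<longlongrightarrow> 0) (at_right 0)}"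


section \<open>Function spaces\<close>

definition L2 :: "real \<Rightarrow> real \<Rightarrow> (real \<Rightarrow> real) set" where
  "L2 a b = {f. f \<in> borel_measurable (lebesgue_on {a<..<b}) \<and>
                integrable (lebesgue_on {a<..<b}) (\<lambda>x. (f x)\<^sup>2)}"

definition abs_continuous :: "real \<Rightarrow> real \<Rightarrow> (real \<Rightarrow> real) \<Rightarrow> bool" where
  "abs_continuous a b f \<longleftrightarrow>
     (\<forall>\<epsilon>>0. \<exists>\<delta>>0. \<forall>(n::nat) (x :: nat \<Rightarrow> real) (y :: nat \<Rightarrow> real).
        (\<forall>i<n. a \<le> x i \<and> x i \<le> y i \<and> y i \<le> b) \<and>
        (\<forall>i<n. \<forall>j<n. i \<noteq> j \<longrightarrow> {x i<..<y i} \<inter> {x j<..<y j} = {}) \<and>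
        (\<Sum>i<n. y i - x i) < \<delta> \<longrightarrow>
        (\<Sum>i<n. \<bar>f (y i) - f (x i)\<bar>) < \<epsilon>)"

text \<open>
  Absolutely continuous functions are differentiable almost everywhere (Lebesgue).  Below this is
  listed explicitly because \<^const>\<open>deriv\<close> is total: it makes \<open>deriv u\<close> the genuine derivative
  \<open>u'\<close> almost everywhere, and it excludes no function.
\<close>

definition H1 :: "(real \<Rightarrow> real) set" where
  "H1 = {f. \<exists>w. abs_continuous 0 1 w \<and>
                (AE x in lebesgue_on {0<..<1}. w differentiable (at x)) \<and>
                deriv w \<in> L2 0 1 \<and>
                (AE x in lebesgue_on {0<..<1}. f x = w x)}"

definition H1a :: "real \<Rightarrow> (real \<Rightarrow> real) set" where
  "H1a \<theta> = {u. u \<in> L2 0 1 \<and>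
                (\<forall>a. 0 < a \<and> a < 1 \<longrightarrow> abs_continuous a 1 u) \<and>
                (AE x in lebesgue_on {0<..<1}. u differentiable (at x)) \<and>
                (\<lambda>x. x powr (\<theta> / 2) * deriv u x) \<in> L2 0 1 \<and>
                u 1 = 0}"

definition H2a :: "real \<Rightarrow> (real \<Rightarrow> real) set" where
  "H2a \<theta> = {u \<in> H1a \<theta>. (\<lambda>x. x powr \<theta> * deriv u x) \<in> H1}"


section \<open>The degenerate wave equation\<close>

type_synonym state = "(real \<Rightarrow> real) \<times> (real \<Rightarrow> real)"

definition state_space :: "real \<Rightarrow> state set" where
  "state_space \<theta> = H1a \<theta> \<times> L2 0 1"

definition state_inner :: "real \<Rightarrow> state \<Rightarrow> state \<Rightarrow> real" where
  "state_inner \<theta> U V =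
     (LINT x|lebesgue_on {0<..<1}.
        snd U x * snd V x + x powr \<theta> * deriv (fst U) x * deriv (fst V) x)"

definition state_norm :: "real \<Rightarrow> state \<Rightarrow> real" where
  "state_norm \<theta> U = sqrt (state_inner \<theta> U U)"

definition wave_map :: "real \<Rightarrow> state \<Rightarrow> state" where
  "wave_map \<theta> U = (snd U, deriv (\<lambda>x. x powr \<theta> * deriv (fst U) x))"

definition wave_domain :: "real \<Rightarrow> state set" where
  "wave_domain \<theta> = H2a \<theta> \<times> H1a \<theta>"

text \<open>The graph of the operator \<open>A\<close>, saturated under equality in the state space.\<close>

definition wave_operator :: "real \<Rightarrow> (state \<times> state) set" where
  "wave_operator \<theta> =
     {(U, V). U \<in> state_space \<theta> \<and> V \<in> state_space \<theta> \<and>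
              (\<exists>W\<in>wave_domain \<theta>. state_norm \<theta> (U - W) = 0 \<and>
                                state_norm \<theta> (V - wave_map \<theta> W) = 0)}"

text \<open>\<open>S t\<close> is \<open>e\<^sup>t\<^sup>A\<close>; by uniqueness of the semigroup with a given generator, \<open>S\<close> is determined up to
  equality in the state space.\<close>

definition wave_semigroup :: "real \<Rightarrow> (real \<Rightarrow> state \<Rightarrow> state) \<Rightarrow> bool" where
  "wave_semigroup \<theta> S \<longleftrightarrow>
     contraction_semigroup (state_space \<theta>) (state_norm \<theta>) S \<and>
     semigroup_generator (state_space \<theta>) (state_norm \<theta>) S = wave_operator \<theta>"

definition mild_solution :: "(real \<Rightarrow> state \<Rightarrow> state) \<Rightarrow> state \<Rightarrow> real \<Rightarrow> real \<Rightarrow> real" where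
  "mild_solution S U\<^sub>0 t = fst (S t U\<^sub>0)"

definition classical_trace :: "(real \<Rightarrow> state \<Rightarrow> state) \<Rightarrow> state \<Rightarrow> real \<Rightarrow> real" where
  "classical_trace S U\<^sub>0 t = vector_derivative (mild_solution S U\<^sub>0 t) (at_left 1)"

text \<open>\<open>g\<close> is the trace \<open>u\<^sub>x(\<cdot>, 1)\<close> of the mild solution with data \<open>U\<^sub>0\<close> (unique almost everywhere).\<close>

definition is_boundary_trace ::
    "real \<Rightarrow> (real \<Rightarrow> state \<Rightarrow> state) \<Rightarrow> real \<Rightarrow> state \<Rightarrow> (real \<Rightarrow> real) \<Rightarrow> bool" where
  "is_boundary_trace \<theta> S T U\<^sub>0 g \<longleftrightarrow>
     g \<in> L2 0 T \<and>
     (\<exists>U :: nat \<Rightarrow> state.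
        (\<forall>n. U n \<in> wave_domain \<theta>) \<and>
        (\<lambda>n. state_norm \<theta> (U n - U\<^sub>0)) \<longlonglongrightarrow> 0 \<and>
        (\<forall>n. classical_trace S (U n) \<in> L2 0 T) \<and>
        (\<lambda>n. LINT t|lebesgue_on {0<..<T}. (classical_trace S (U n) t - g t)\<^sup>2) \<longlonglongrightarrow> 0)"

text \<open>The velocity \<open>u\<^sub>t(t, \<cdot>)\<close> of a mild solution is the second component of \<open>S t U\<^sub>0\<close>.\<close>

definition energy :: "real \<Rightarrow> (real \<Rightarrow> state \<Rightarrow> state) \<Rightarrow> state \<Rightarrow> real \<Rightarrow> real" where
  "energy \<theta> S U\<^sub>0 t =
     1 / 2 * (LINT x|lebesgue_on {0<..<1}.
                (snd (S t U\<^sub>0) x)\<^sup>2 + x powr \<theta> * (deriv (mild_solution S U\<^sub>0 t) x)\<^sup>2)"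

definition observability_constant :: "real \<Rightarrow> (real \<Rightarrow> state \<Rightarrow> state) \<Rightarrow> real \<Rightarrow> ereal" where
  "observability_constant \<theta> S T =
     Inf {ereal ((LINT t|lebesgue_on {0<..<T}. (g t)\<^sup>2) / energy \<theta> S U\<^sub>0 0) | U\<^sub>0 g.
            U\<^sub>0 \<in> state_space \<theta> \<and> state_norm \<theta> U\<^sub>0 \<noteq> 0 \<and> is_boundary_trace \<theta> S T U\<^sub>0 g}"

end

theory Submission
  imports Defs
begin

text \<open>
  Standing waves give the bound.  Let \<open>\<Phi>\<close> be an eigenfunction,
  \<open>(x\<^sup>\<theta> \<Phi>')' = - \<omega>\<^sup>2 \<Phi>\<close> with \<open>\<Phi>(1) = 0\<close> and \<open>x\<^sup>\<theta> \<Phi>' \<rightarrow> 0\<close> at \<open>0\<close>.  The solutions with data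
  \<open>(\<Phi>, 0)\<close> and \<open>(0, \<Phi>)\<close> are \<open>cos (\<omega> t) \<Phi>\<close> and \<open>sin (\<omega> t) / \<omega> \<Phi>\<close>.  The multiplier \<open>x \<Phi>'\<close>
  relates the boundary derivative to the energy, \<open>\<Phi>'(1)\<^sup>2 = (2 - \<theta>) \<integral> x\<^sup>\<theta> \<Phi>'\<^sup>2\<close>
  (\<open>integral_identities\<close>), so the observability quotients of the two solutions are
  \<open>2 (2 - \<theta>) \<integral> cos\<^sup>2 (\<omega> t)\<close> and \<open>2 (2 - \<theta>) \<integral> sin\<^sup>2 (\<omega> t)\<close>, integrated over \<open>[0, T]\<close>.  Their mean
  is \<open>(2 - \<theta>) T\<close>, so one of them is at most \<open>(2 - \<theta>) T\<close>.  Hence one eigenfunction suffices.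

  Three points need an argument.  The first is the existence of an eigenfunction.  It is
  \<open>\<Phi>(x) = f (c x\<^bsup>2 - \<theta>\<^esup>)\<close>, where \<open>f\<close> is an explicit power series, essentially a Bessel function, and
  \<open>c\<close> is a positive zero of \<open>f\<close>.  Such a zero exists by comparison with the test function
  \<open>(Z - z)\<^sup>2\<close> (\<open>hyp_has_positive_zero\<close>).

  The second is that the semigroup, of which only the generator is known, moves the two data as
  stated.  The generator leaves the plane that they span invariant, and a contraction semigroup
  follows every curve that satisfies its evolution equation up to an error \<open>o(h)\<close> in each step of
  length \<open>h\<close> (\<open>approximate_solution_eq_semigroup\<close>, \<open>semigroup_on_rotation_plane\<close>).

  The third is that the semigroup is determined only up to states of norm \<open>0\<close>, whereas the boundary
  trace is a pointwise derivative.  A position of norm \<open>0\<close> has derivative \<open>0\<close> almost everywhere and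
  is absolutely continuous away from \<open>0\<close>, so it vanishes identically on \<open>]0, 1]\<close>
  (\<open>abs_continuous_const_if_deriv_zero_ae\<close>, \<open>position_zero_if_state_norm_zero\<close>).
\<close>

section \<open>Absolutely continuous functions\<close>

lemma abs_continuousD:
  assumes "abs_continuous a b f" "e > 0"
  shows "\<exists>d>0. \<forall>(n::nat) x y. (\<forall>i<n. a \<le> x i \<and> x i \<le> y i \<and> y i \<le> b) \<and>
      (\<forall>i<n. \<forall>j<n. i \<noteq> j \<longrightarrow> {x i<..<y i} \<inter> {x j<..<y j} = {}) \<and>
      (\<Sum>i<n. y i - x i) < d \<longrightarrow> (\<Sum>i<n. \<bar>f (y i) - f (x i)\<bar>) < e"
  using assms(1)[unfolded abs_continuous_def, rule_format, OF assms(2)] .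

text \<open>
  A gauge argument.  Cover the exceptional null set by an open set \<open>G\<close> of measure less than the
  \<open>\<delta>\<close> of absolute continuity, and take a tagged division fine for the gauge that is \<open>G\<close> at
  exceptional tags and elsewhere a ball in which the difference quotient is at most \<open>e\<close>.  The pieces
  with exceptional tags then contribute at most \<open>e\<close> to \<open>f b - f a\<close> by absolute continuity, the
  others at most \<open>e * (b - a)\<close>.
\<close>

lemma abs_continuous_const_if_deriv_zero_ae:
  fixes f :: "real \<Rightarrow> real"
  assumes ac: "abs_continuous a b f" and "a \<le> b" and neg: "negligible E"
    and der: "\<And>x. x \<in> {a<..<b} - E \<Longrightarrow> (f has_real_derivative 0) (at x)"
  shows "f b = f a"
proof -
  \<comment> \<open>The endpoints join the exceptional set, because the derivative is known only in the interior.\<close>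
  define E' where "E' = E \<union> {a, b}"
  have negE': "negligible E'"
    unfolding E'_def using neg by (intro negligible_Un) auto
  have small: "\<bar>f b - f a\<bar> \<le> e + e * (b - a)" if "e > 0" for e
  proof -
    obtain \<delta> where \<delta>: "\<delta> > 0" "\<forall>(n::nat) x y. (\<forall>i<n. a \<le> x i \<and> x i \<le> y i \<and> y i \<le> b) \<and>
      (\<forall>i<n. \<forall>j<n. i \<noteq> j \<longrightarrow> {x i<..<y i} \<inter> {x j<..<y j} = {}) \<and>
      (\<Sum>i<n. y i - x i) < \<delta> \<longrightarrow> (\<Sum>i<n. \<bar>f (y i) - f (x i)\<bar>) < e"
    using abs_continuousD[OF ac \<open>e > 0\<close>] by (elim exE conjE)
    have null: "E' \<in> null_sets lebesgue"
      using negE' negligible_iff_null_sets by blast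
    obtain G where G: "open G" "E' \<subseteq> G" "G - E' \<in> lmeasurable" "emeasure lebesgue (G - E') < ennreal \<delta>"
      using sets_lebesgue_outer_open[of E' \<delta>] null \<delta>(1) by blast
    have Gm: "G \<in> lmeasurable"
    proof -
      have "(G - E') \<union> E' \<in> lmeasurable"
        using G(3) null by (intro fmeasurable.Un) (auto simp: fmeasurable_def null_sets_def)
      then show ?thesis using G(2) by (simp add: Un_absorb2)
    qed
    have Gmeas: "measure lebesgue G < \<delta>"
    proof -
      have "emeasure lebesgue G = emeasure lebesgue (G - E')"
        using emeasure_Diff_null_set[OF null, of G] Gm by (simp add: fmeasurableD)
      then show ?thesis
        using G(4) \<delta>(1) Gm by (metis emeasure_eq_measure2 ennreal_less_iff measure_nonneg)
    qed
    have "\<forall>x. \<exists>d>0. x \<in> {a..b} - E' \<longrightarrow> (\<forall>y. \<bar>y - x\<bar> < d \<longrightarrow> \<bar>f y - f x\<bar> \<le> e * \<bar>y - x\<bar>)"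
    proof
      fix x
      show "\<exists>d>0. x \<in> {a..b} - E' \<longrightarrow> (\<forall>y. \<bar>y - x\<bar> < d \<longrightarrow> \<bar>f y - f x\<bar> \<le> e * \<bar>y - x\<bar>)"
      proof (cases "x \<in> {a..b} - E'")
        case True
        then have "x \<in> {a<..<b} - E" by (auto simp: E'_def less_le)
        from der[OF this] have "(f has_derivative (*) 0) (at x)"
          by (simp add: has_field_derivative_def)
        then show ?thesis
          unfolding has_derivative_at_alt using \<open>e > 0\<close> by fastforce
      next
        case False then show ?thesis by (intro exI[of _ 1]) auto
      qed
    qed
    then obtain d where d0: "\<And>x. d x > 0"
      and d: "\<And>x y. x \<in> {a..b} - E' \<Longrightarrow> \<bar>y - x\<bar> < d x \<Longrightarrow> \<bar>f y - f x\<bar> \<le> e * \<bar>y - x\<bar>"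
      by metis
    define \<gamma> where "\<gamma> x = (if x \<in> E' then G else ball x (d x))" for x
    have "gauge \<gamma>"
      unfolding gauge_def \<gamma>_def using d0 G by auto
    then obtain p where p: "p tagged_division_of {a..b}" "\<gamma> fine p"
      using fine_division_exists_real by blast
    have fin: "finite p" using p(1) by blast
    define incr where "incr = (\<lambda>(x::real, K::real set). f (Sup K) - f (Inf K))"
    have tot: "f b - f a = sum incr p"
      unfolding incr_def using additive_tagged_division_1[OF \<open>a \<le> b\<close> p(1), of f] by simp
    define p1 where "p1 = {z \<in> p. fst z \<in> E'}"
    define p2 where "p2 = {z \<in> p. fst z \<notin> E'}"
    have pp: "p = p1 \<union> p2" "p1 \<inter> p2 = {}" "finite p1" "finite p2"
      using fin by (auto simp: p1_def p2_def)
    have K: "\<exists>u v. K = {u..v} \<and> u \<le> v \<and> x \<in> K \<and> a \<le> u \<and> v \<le> b \<and> Inf K = u \<and> Sup K = v" if xKp: "(x, K) \<in> p" for x K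
    proof -
      obtain u v where "K = cbox u v" using tagged_division_ofD(4)[OF p(1) xKp] by blast
      moreover have "x \<in> K" "K \<subseteq> {a..b}" using tagged_division_ofD(2,3)[OF p(1) xKp] by auto
      ultimately show ?thesis by (intro exI[of _ u] exI[of _ v]) (auto simp: subset_iff)
    qed
    have sum2: "\<bar>sum incr p2\<bar> \<le> e * (b - a)"
    proof -
      have "\<bar>incr z\<bar> \<le> e * measure lborel (snd z)" if "z \<in> p2" for z
      proof -
        obtain x K where z: "z = (x, K)" by force
        have xK: "(x, K) \<in> p" "x \<notin> E'" using that z by (auto simp: p2_def)
        obtain u v where uv: "K = {u..v}" "u \<le> v" "x \<in> K" "a \<le> u" "v \<le> b" "Inf K = u" "Sup K = v"
          using K[OF xK(1)] by blast
        have sub: "{u..v} \<subseteq> ball x (d x)" using fineD[OF p(2) xK(1)] xK(2) uv(1) by (simp add: \<gamma>_def)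
        have "u \<in> ball x (d x)" "v \<in> ball x (d x)" using sub uv(2) by auto
        then have "\<bar>u - x\<bar> < d x" "\<bar>v - x\<bar> < d x" by (auto simp: dist_real_def)
        moreover have "x \<in> {a..b} - E'" using uv xK by auto
        ultimately have "\<bar>f u - f x\<bar> \<le> e * \<bar>u - x\<bar>" "\<bar>f v - f x\<bar> \<le> e * \<bar>v - x\<bar>" using d by auto
        then have "\<bar>f v - f u\<bar> \<le> e * \<bar>u - x\<bar> + e * \<bar>v - x\<bar>" by linarith
        also have "\<dots> = e * (v - u)" using uv by (simp add: algebra_simps)
        finally show ?thesis using uv z by (simp add: incr_def)
      qed
      then have "\<bar>sum incr p2\<bar> \<le> (\<Sum>z\<in>p2. e * measure lborel (snd z))"
        by (intro order_trans[OF sum_abs] sum_mono)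
      also have "\<dots> \<le> (\<Sum>z\<in>p. e * measure lborel (snd z))"
        using pp \<open>e > 0\<close> by (intro sum_mono2[OF fin]) auto
      also have "\<dots> = e * (\<Sum>(x,K)\<in>p. measure lborel K)"
        by (simp add: sum_distrib_left case_prod_unfold)
      also have "\<dots> = e * (b - a)"
        using additive_content_tagged_division[of p a b] p(1) \<open>a \<le> b\<close> by simp
      finally show ?thesis .
    qed
    have sum1: "\<bar>sum incr p1\<bar> \<le> e"
    proof -
      obtain h where h: "bij_betw h {0..<card p1} p1"
        using ex_bij_betw_nat_finite[OF pp(3)] by blast
      define n where "n = card p1"
      have h: "bij_betw h {..<n} p1" using h by (simp add: n_def lessThan_atLeast0)
      have hp: "h i \<in> p1" if "i < n" for i using h that bij_betwE by blast
      define x y where "x i = Inf (snd (h i))" and "y i = Sup (snd (h i))" for i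
      have hi: "snd (h i) = {x i..y i} \<and> x i \<le> y i \<and> a \<le> x i \<and> y i \<le> b" if "i < n" for i
      proof -
        have "(fst (h i), snd (h i)) \<in> p" using hp[OF that] by (simp add: p1_def)
        from K[OF this] show ?thesis unfolding x_def y_def by auto
      qed
      have disj: "{x i<..<y i} \<inter> {x j<..<y j} = {}" if "i < n" "j < n" "i \<noteq> j" for i j
      proof -
        have "h i \<noteq> h j" using h that unfolding bij_betw_def inj_on_def by auto
        then have "interior (snd (h i)) \<inter> interior (snd (h j)) = {}"
          using hp[OF that(1)] hp[OF that(2)] tagged_division_ofD(5)[OF p(1), of "fst (h i)" "snd (h i)" "fst (h j)" "snd (h j)"]
          by (auto simp: p1_def)
        then show ?thesis using hi[OF that(1)] hi[OF that(2)] by simp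
      qed
      have "(\<Sum>i<n. y i - x i) = (\<Sum>i<n. measure lebesgue {x i<..<y i})"
        using hi by (intro sum.cong) auto
      also have "\<dots> = measure lebesgue (\<Union>i<n. {x i<..<y i})"
        by (rule measure_UNION'[symmetric]) (use disj in \<open>auto simp: pairwise_def disjnt_def\<close>)
      also have "\<dots> \<le> measure lebesgue G"
      proof (rule measure_mono_fmeasurable[OF _ _ Gm])
        show "(\<Union>i<n. {x i<..<y i}) \<subseteq> G"
        proof (intro UN_least)
          fix i assume "i \<in> {..<n}"
          then have "i < n" by simp
          have "(fst (h i), snd (h i)) \<in> p" "fst (h i) \<in> E'" using hp[OF \<open>i < n\<close>] by (auto simp: p1_def)
          then have "snd (h i) \<subseteq> G" using fineD[OF p(2), of "fst (h i)" "snd (h i)"] by (simp add: \<gamma>_def)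
          then show "{x i<..<y i} \<subseteq> G" using hi[OF \<open>i < n\<close>] by auto
        qed
        show "(\<Union>i<n. {x i<..<y i}) \<in> sets lebesgue"
          by (intro sets.finite_UN) auto
      qed
      finally have lt: "(\<Sum>i<n. y i - x i) < \<delta>" using Gmeas by simp
      have "(\<Sum>i<n. \<bar>f (y i) - f (x i)\<bar>) < e"
        by (rule \<delta>(2)[rule_format]) (use hi disj lt in auto)
      moreover have "sum incr p1 = (\<Sum>i<n. f (y i) - f (x i))"
        unfolding sum.reindex_bij_betw[OF h, symmetric]
        by (simp add: incr_def x_def y_def case_prod_unfold)
      ultimately show ?thesis
        using sum_abs[of "\<lambda>i. f (y i) - f (x i)" "{..<n}"] by linarith
    qed
    have "sum incr p = sum incr p1 + sum incr p2"
      using pp by (metis sum.union_disjoint)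
    then show ?thesis using tot sum1 sum2 by linarith
  qed
  have "\<bar>f b - f a\<bar> \<le> 0"
  proof (rule ccontr)
    assume "\<not> ?thesis"
    then have pos: "\<bar>f b - f a\<bar> > 0" by simp
    have "1 + (b - a) > 0" using \<open>a \<le> b\<close> by simp
    define e where "e = \<bar>f b - f a\<bar> / (2 * (1 + (b - a)))"
    have "e > 0" using pos \<open>1 + (b - a) > 0\<close> by (simp add: e_def)
    have "e * (1 + (b - a)) = \<bar>f b - f a\<bar> / 2"
      using \<open>1 + (b - a) > 0\<close> by (simp add: e_def field_simps)
    then have "e + e * (b - a) = \<bar>f b - f a\<bar> / 2" by (simp only: distrib_left mult_1_right)
    then have "\<bar>f b - f a\<bar> \<le> \<bar>f b - f a\<bar> / 2" using small[OF \<open>e > 0\<close>] by simp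
    then show False using pos by simp
  qed
  then show ?thesis by simp
qed

lemma abs_continuous_linear_combination:
  assumes f: "abs_continuous a b f" and g: "abs_continuous a b g"
  shows "abs_continuous a b (\<lambda>x. p * f x + q * g x)"
  unfolding abs_continuous_def
proof (intro allI impI)
  fix e :: real assume "e > 0"
  define m where "m = \<bar>p\<bar> + \<bar>q\<bar> + 1"
  have m: "m > 0" "\<bar>p\<bar> + \<bar>q\<bar> < m" by (simp_all add: m_def add_nonneg_pos)
  have em: "e / m > 0" using \<open>e > 0\<close> m by simp
  obtain d1 where d1: "d1 > 0" "\<forall>(n::nat) x y. (\<forall>i<n. a \<le> x i \<and> x i \<le> y i \<and> y i \<le> b) \<and>
      (\<forall>i<n. \<forall>j<n. i \<noteq> j \<longrightarrow> {x i<..<y i} \<inter> {x j<..<y j} = {}) \<and>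
      (\<Sum>i<n. y i - x i) < d1 \<longrightarrow> (\<Sum>i<n. \<bar>f (y i) - f (x i)\<bar>) < e / m"
    using abs_continuousD[OF f em] by (elim exE conjE)
  obtain d2 where d2: "d2 > 0" "\<forall>(n::nat) x y. (\<forall>i<n. a \<le> x i \<and> x i \<le> y i \<and> y i \<le> b) \<and>
      (\<forall>i<n. \<forall>j<n. i \<noteq> j \<longrightarrow> {x i<..<y i} \<inter> {x j<..<y j} = {}) \<and>
      (\<Sum>i<n. y i - x i) < d2 \<longrightarrow> (\<Sum>i<n. \<bar>g (y i) - g (x i)\<bar>) < e / m"
    using abs_continuousD[OF g em] by (elim exE conjE)
  show "\<exists>d>0. \<forall>(n::nat) x y.
        (\<forall>i<n. a \<le> x i \<and> x i \<le> y i \<and> y i \<le> b) \<and>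
        (\<forall>i<n. \<forall>j<n. i \<noteq> j \<longrightarrow> {x i<..<y i} \<inter> {x j<..<y j} = {}) \<and>
        (\<Sum>i<n. y i - x i) < d \<longrightarrow>
        (\<Sum>i<n. \<bar>p * f (y i) + q * g (y i) - (p * f (x i) + q * g (x i))\<bar>) < e"
  proof (intro exI[of _ "min d1 d2"] conjI allI impI)
    show "min d1 d2 > 0" using d1 d2 by simp
    fix n :: nat and x y :: "nat \<Rightarrow> real"
    assume H: "(\<forall>i<n. a \<le> x i \<and> x i \<le> y i \<and> y i \<le> b) \<and>
        (\<forall>i<n. \<forall>j<n. i \<noteq> j \<longrightarrow> {x i<..<y i} \<inter> {x j<..<y j} = {}) \<and>
        (\<Sum>i<n. y i - x i) < min d1 d2"
    have F: "(\<Sum>i<n. \<bar>f (y i) - f (x i)\<bar>) < e / m"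
      by (rule d1(2)[rule_format]) (use H in simp)
    have G: "(\<Sum>i<n. \<bar>g (y i) - g (x i)\<bar>) < e / m"
      by (rule d2(2)[rule_format]) (use H in simp)
    have "(\<Sum>i<n. \<bar>p * f (y i) + q * g (y i) - (p * f (x i) + q * g (x i))\<bar>)
        \<le> (\<Sum>i<n. \<bar>p\<bar> * \<bar>f (y i) - f (x i)\<bar> + \<bar>q\<bar> * \<bar>g (y i) - g (x i)\<bar>)"
    proof (rule sum_mono)
      fix i
      have "p * f (y i) + q * g (y i) - (p * f (x i) + q * g (x i))
          = p * (f (y i) - f (x i)) + q * (g (y i) - g (x i))" by (simp add: algebra_simps)
      then show "\<bar>p * f (y i) + q * g (y i) - (p * f (x i) + q * g (x i))\<bar>
          \<le> \<bar>p\<bar> * \<bar>f (y i) - f (x i)\<bar> + \<bar>q\<bar> * \<bar>g (y i) - g (x i)\<bar>"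
        by (metis abs_mult abs_triangle_ineq)
    qed
    also have "\<dots> = \<bar>p\<bar> * (\<Sum>i<n. \<bar>f (y i) - f (x i)\<bar>) + \<bar>q\<bar> * (\<Sum>i<n. \<bar>g (y i) - g (x i)\<bar>)"
      by (simp add: sum.distrib sum_distrib_left)
    also have "\<dots> \<le> \<bar>p\<bar> * (e / m) + \<bar>q\<bar> * (e / m)"
      using F G by (intro add_mono mult_left_mono) auto
    also have "\<dots> = (\<bar>p\<bar> + \<bar>q\<bar>) * (e / m)" by (simp add: algebra_simps)
    also have "\<dots> < m * (e / m)" using m em by (intro mult_strict_right_mono) auto
    also have "\<dots> = e" using m by simp
    finally show "(\<Sum>i<n. \<bar>p * f (y i) + q * g (y i) - (p * f (x i) + q * g (x i))\<bar>) < e" .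
  qed
qed

text \<open>
  By the mean value theorem, such a function is Lipschitz.
\<close>

lemma abs_continuous_if_continuous_deriv:
  assumes "continuous_on {a..b} f" and g: "continuous_on {a..b} g"
    and der: "\<And>x. x \<in> {a<..<b} \<Longrightarrow> (f has_real_derivative g x) (at x)"
  shows "abs_continuous a b f"
proof -
  have "bounded (g ` {a..b})"
    using g compact_continuous_image compact_imp_bounded by blast
  then obtain M where M: "M > 0" "\<And>x. x \<in> {a..b} \<Longrightarrow> \<bar>g x\<bar> \<le> M"
    unfolding bounded_pos by (auto simp: image_iff)
  have lip: "\<bar>f y - f x\<bar> \<le> M * (y - x)" if "a \<le> x" "x \<le> y" "y \<le> b" for x y
  proof (cases "x = y")
    case False
    then have "x < y" using that by simp
    have c: "continuous_on {x..y} f"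
      by (rule continuous_on_subset[OF assms(1)]) (use that in auto)
    have "f differentiable (at w)" if "x < w" "w < y" for w
      using der[of w] that \<open>a \<le> x\<close> \<open>y \<le> b\<close> by (auto simp: real_differentiable_def)
    from MVT[OF \<open>x < y\<close> c this] obtain l z
      where z: "x < z" "z < y" "(f has_real_derivative l) (at z)" "f y - f x = (y - x) * l"
      by blast
    have "l = g z"
      by (rule DERIV_unique[OF z(3) der]) (use z that in auto)
    moreover have "\<bar>g z\<bar> \<le> M"
      by (rule M(2)) (use z that in auto)
    ultimately show ?thesis
      using z(4) \<open>x < y\<close> by (simp add: abs_mult mult.commute mult_right_mono)
  qed auto
  show ?thesis
    unfolding abs_continuous_def
  proof (intro allI impI)
    fix e :: real assume "e > 0"
    show "\<exists>d>0. \<forall>(n::nat) x y.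
        (\<forall>i<n. a \<le> x i \<and> x i \<le> y i \<and> y i \<le> b) \<and>
        (\<forall>i<n. \<forall>j<n. i \<noteq> j \<longrightarrow> {x i<..<y i} \<inter> {x j<..<y j} = {}) \<and>
        (\<Sum>i<n. y i - x i) < d \<longrightarrow> (\<Sum>i<n. \<bar>f (y i) - f (x i)\<bar>) < e"
    proof (intro exI[of _ "e / M"] conjI allI impI)
      show "e / M > 0" using \<open>e > 0\<close> M by simp
      fix n :: nat and x y :: "nat \<Rightarrow> real"
      assume H: "(\<forall>i<n. a \<le> x i \<and> x i \<le> y i \<and> y i \<le> b) \<and>
        (\<forall>i<n. \<forall>j<n. i \<noteq> j \<longrightarrow> {x i<..<y i} \<inter> {x j<..<y j} = {}) \<and>
        (\<Sum>i<n. y i - x i) < e / M"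
      then have "(\<Sum>i<n. \<bar>f (y i) - f (x i)\<bar>) \<le> (\<Sum>i<n. M * (y i - x i))"
        by (intro sum_mono lip) auto
      also have "\<dots> = M * (\<Sum>i<n. y i - x i)" by (simp add: sum_distrib_left)
      also have "\<dots> < M * (e / M)" using H M by (intro mult_strict_left_mono) auto
      finally show "(\<Sum>i<n. \<bar>f (y i) - f (x i)\<bar>) < e" using M by simp
    qed
  qed
qed

section \<open>Square-integrable functions\<close>

lemma L2_mult_integrable:
  assumes "f \<in> L2 a b" "g \<in> L2 a b"
  shows "integrable (lebesgue_on {a<..<b}) (\<lambda>x. f x * g x)"
proof (rule Bochner_Integration.integrable_bound)
  show "integrable (lebesgue_on {a<..<b}) (\<lambda>x. (f x)\<^sup>2 + (g x)\<^sup>2)"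
    using assms by (auto simp: L2_def)
  show "(\<lambda>x. f x * g x) \<in> borel_measurable (lebesgue_on {a<..<b})"
    using assms by (auto simp: L2_def)
  have "\<bar>p * q\<bar> \<le> p\<^sup>2 + q\<^sup>2" for p q :: real
  proof -
    have "2 * (\<bar>p\<bar> * \<bar>q\<bar>) \<le> p\<^sup>2 + q\<^sup>2"
      using sum_squares_bound[of "\<bar>p\<bar>" "\<bar>q\<bar>"] by simp
    moreover have "0 \<le> \<bar>p\<bar> * \<bar>q\<bar>" by simp
    ultimately show ?thesis by (simp only: abs_mult)
  qed
  then show "AE x in lebesgue_on {a<..<b}. norm (f x * g x) \<le> norm ((f x)\<^sup>2 + (g x)\<^sup>2)"
    by simp
qed

lemma L2_linear_combination:
  assumes "f \<in> L2 a b" "g \<in> L2 a b"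
  shows "(\<lambda>x. p * f x + q * g x) \<in> L2 a b"
proof -
  have "integrable (lebesgue_on {a<..<b}) (\<lambda>x. p\<^sup>2 * (f x)\<^sup>2 + (2 * p * q) * (f x * g x) + q\<^sup>2 * (g x)\<^sup>2)"
    using assms L2_mult_integrable[OF assms] by (auto simp: L2_def)
  moreover have "(\<lambda>x. p\<^sup>2 * (f x)\<^sup>2 + (2 * p * q) * (f x * g x) + q\<^sup>2 * (g x)\<^sup>2) = (\<lambda>x. (p * f x + q * g x)\<^sup>2)"
    by (simp add: power2_eq_square algebra_simps)
  ultimately show ?thesis using assms by (auto simp: L2_def)
qed

lemma borel_measurable_lebesgue_on_cong_AE:
  fixes f g :: "real \<Rightarrow> real"
  assumes f: "f \<in> borel_measurable (lebesgue_on S)" and S: "S \<in> sets lebesgue"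
    and eq: "AE x in lebesgue_on S. f x = g x"
  shows "g \<in> borel_measurable (lebesgue_on S)"
proof -
  have "AE x in lebesgue. (if x \<in> S then f x else 0) = (if x \<in> S then g x else 0)"
    using eq S by (subst (asm) AE_restrict_space_iff) (auto elim: eventually_mono)
  then have "(\<lambda>x. if x \<in> S then g x else 0) \<in> borel_measurable lebesgue"
    by (rule borel_measurable_AE[rotated]) (use f S borel_measurable_if in blast)
  then show ?thesis using S borel_measurable_if by blast
qed

lemma L2_cong_AE:
  assumes "f \<in> L2 a b" "AE x in lebesgue_on {a<..<b}. f x = g x"
  shows "g \<in> L2 a b"
proof -
  have g: "g \<in> borel_measurable (lebesgue_on {a<..<b})"
    by (rule borel_measurable_lebesgue_on_cong_AE[OF _ _ assms(2)]) (use assms(1) in \<open>auto simp: L2_def\<close>)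
  have "integrable (lebesgue_on {a<..<b}) (\<lambda>x. (g x)\<^sup>2)"
    by (rule integrable_cong_AE_imp[of _ "\<lambda>x. (f x)\<^sup>2"])
      (use assms g in \<open>auto simp: L2_def elim: eventually_mono\<close>)
  then show ?thesis using g by (simp add: L2_def)
qed

lemma integrable_open_interval_if_continuous:
  fixes f g :: "real \<Rightarrow> real"
  assumes g: "continuous_on {a..b} g" and eq: "\<And>x. x \<in> {a<..<b} \<Longrightarrow> f x = g x"
  shows "integrable (lebesgue_on {a<..<b}) f"
    and "(LINT x|lebesgue_on {a<..<b}. f x) = integral {a..b} g"
proof -
  have "g absolutely_integrable_on {a..b}"
    using g by (rule absolutely_integrable_continuous_real)
  then have "g absolutely_integrable_on {a<..<b}"
    by (rule set_integrable_subset) auto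
  then have g': "integrable (lebesgue_on {a<..<b}) g"
    by (simp add: set_integrable_def integrable_restrict_space)
  then show "integrable (lebesgue_on {a<..<b}) f"
    by (subst Bochner_Integration.integrable_cong[OF refl, of _ f g]) (use eq in auto)
  have "(LINT x|lebesgue_on {a<..<b}. f x) = (LINT x|lebesgue_on {a<..<b}. g x)"
    by (rule Bochner_Integration.integral_cong) (use eq in auto)
  also have "\<dots> = integral {a<..<b} g"
    using g' by (rule lebesgue_integral_eq_integral) auto
  finally show "(LINT x|lebesgue_on {a<..<b}. f x) = integral {a..b} g"
    by (simp add: integral_open_interval_real)
qed

lemma L2_if_continuous:
  assumes g: "continuous_on {a..b} g" and eq: "\<And>x. x \<in> {a<..<b} \<Longrightarrow> f x = g x"
  shows "f \<in> L2 a b"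
  unfolding L2_def
proof (intro CollectI conjI)
  show "f \<in> borel_measurable (lebesgue_on {a<..<b})"
    using integrable_open_interval_if_continuous(1)[OF assms] by (rule borel_measurable_integrable)
  show "integrable (lebesgue_on {a<..<b}) (\<lambda>x. (f x)\<^sup>2)"
    by (rule integrable_open_interval_if_continuous(1)[of _ _ "\<lambda>x. (g x)\<^sup>2"])
      (use assms in \<open>auto intro: continuous_intros\<close>)
qed

section \<open>The state space as a seminormed space\<close>

definition weighted_deriv :: "real \<Rightarrow> (real \<Rightarrow> real) \<Rightarrow> real \<Rightarrow> real" where
  "weighted_deriv \<theta> u x = x powr (\<theta> / 2) * deriv u x"

lemma deriv_linear_combination:
  fixes u v :: "real \<Rightarrow> real"
  assumes "u differentiable (at x)" "v differentiable (at x)"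
  shows "deriv (\<lambda>x. p * u x + q * v x) x = p * deriv u x + q * deriv v x"
proof -
  have "(u has_real_derivative deriv u x) (at x)" "(v has_real_derivative deriv v x) (at x)"
    using assms by (auto simp: DERIV_deriv_iff_real_differentiable)
  then show ?thesis
    by (intro DERIV_imp_deriv) (auto intro!: derivative_eq_intros)
qed

lemma AE_weighted_deriv_linear_combination:
  assumes "u \<in> H1a \<theta>" "v \<in> H1a \<theta>"
  shows "AE x in lebesgue_on {0<..<1}. weighted_deriv \<theta> (\<lambda>x. p * u x + q * v x) x
      = p * weighted_deriv \<theta> u x + q * weighted_deriv \<theta> v x"
proof -
  have "AE x in lebesgue_on {0<..<1}. u differentiable (at x)"
       "AE x in lebesgue_on {0<..<1}. v differentiable (at x)"
    using assms by (auto simp: H1a_def)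
  then show ?thesis
    by eventually_elim (simp add: weighted_deriv_def deriv_linear_combination algebra_simps)
qed

lemma H1a_linear_combination:
  assumes u: "u \<in> H1a \<theta>" and v: "v \<in> H1a \<theta>"
  shows "(\<lambda>x. p * u x + q * v x) \<in> H1a \<theta>"
  unfolding H1a_def mem_Collect_eq
proof (intro conjI allI impI)
  show "(\<lambda>x. p * u x + q * v x) \<in> L2 0 1"
    using assms by (intro L2_linear_combination) (auto simp: H1a_def)
  show "abs_continuous a 1 (\<lambda>x. p * u x + q * v x)" if "0 < a \<and> a < 1" for a
    using assms that by (intro abs_continuous_linear_combination) (auto simp: H1a_def)
  have "AE x in lebesgue_on {0<..<1}. u differentiable (at x)"
       "AE x in lebesgue_on {0<..<1}. v differentiable (at x)"
    using assms by (auto simp: H1a_def)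
  then show "AE x in lebesgue_on {0<..<1}. (\<lambda>x. p * u x + q * v x) differentiable (at x)"
    by eventually_elim (intro differentiable_add differentiable_mult differentiable_const)
  show "(\<lambda>x. x powr (\<theta> / 2) * deriv (\<lambda>x. p * u x + q * v x) x) \<in> L2 0 1"
  proof (rule L2_cong_AE)
    show "(\<lambda>x. p * weighted_deriv \<theta> u x + q * weighted_deriv \<theta> v x) \<in> L2 0 1"
      using assms by (intro L2_linear_combination) (auto simp: H1a_def weighted_deriv_def[abs_def])
    show "AE x in lebesgue_on {0<..<1}. p * weighted_deriv \<theta> u x + q * weighted_deriv \<theta> v x
        = x powr (\<theta> / 2) * deriv (\<lambda>x. p * u x + q * v x) x"
      using AE_weighted_deriv_linear_combination[OF assms, of p q]
      by (auto simp: weighted_deriv_def elim: eventually_mono)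
  qed
  show "p * u 1 + q * v 1 = 0" using assms by (simp add: H1a_def)
qed

lemma state_linear_combination:
  fixes U V :: state
  shows "p *\<^sub>R U + q *\<^sub>R V = (\<lambda>x. p * fst U x + q * fst V x, \<lambda>x. p * snd U x + q * snd V x)"
  by (simp add: prod_eq_iff scaleR_fun_def fun_eq_iff)

lemma state_space_linear_combination:
  assumes "U \<in> state_space \<theta>" "V \<in> state_space \<theta>"
  shows "p *\<^sub>R U + q *\<^sub>R V \<in> state_space \<theta>"
  using assms unfolding state_linear_combination state_space_def
  by (auto intro: H1a_linear_combination L2_linear_combination)

lemma state_inner_eq:
  "state_inner \<theta> U V = (LINT x|lebesgue_on {0<..<1}.
     snd U x * snd V x + weighted_deriv \<theta> (fst U) x * weighted_deriv \<theta> (fst V) x)"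
  unfolding state_inner_def
proof (rule Bochner_Integration.integral_cong[OF refl])
  fix x :: real assume "x \<in> space (lebesgue_on {0<..<1})"
  have "x powr \<theta> = x powr (\<theta> / 2) * x powr (\<theta> / 2)"
    by (simp add: powr_add[symmetric])
  then show "snd U x * snd V x + x powr \<theta> * deriv (fst U) x * deriv (fst V) x
      = snd U x * snd V x + weighted_deriv \<theta> (fst U) x * weighted_deriv \<theta> (fst V) x"
    by (simp add: weighted_deriv_def)
qed

lemma state_space_L2:
  assumes "U \<in> state_space \<theta>"
  shows "snd U \<in> L2 0 1" "weighted_deriv \<theta> (fst U) \<in> L2 0 1"
  using assms by (auto simp: state_space_def H1a_def weighted_deriv_def[abs_def])

lemma state_inner_integrable:
  assumes "U \<in> state_space \<theta>" "V \<in> state_space \<theta>"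
  shows "integrable (lebesgue_on {0<..<1})
    (\<lambda>x. snd U x * snd V x + weighted_deriv \<theta> (fst U) x * weighted_deriv \<theta> (fst V) x)"
  using assms by (intro Bochner_Integration.integrable_add L2_mult_integrable state_space_L2)

lemma state_inner_nonneg: "state_inner \<theta> U U \<ge> 0"
  unfolding state_inner_eq by (intro Bochner_Integration.integral_nonneg) auto

lemma state_inner_linear_combination:
  assumes U: "U \<in> state_space \<theta>" and V: "V \<in> state_space \<theta>"
  shows "state_inner \<theta> (p *\<^sub>R U + q *\<^sub>R V) (p *\<^sub>R U + q *\<^sub>R V)
    = p\<^sup>2 * state_inner \<theta> U U + 2 * p * q * state_inner \<theta> U V + q\<^sup>2 * state_inner \<theta> V V"
proof -
  let ?I = "lebesgue_on {0<..<1::real}"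
  let ?W = "p *\<^sub>R U + q *\<^sub>R V"
  let ?b = "\<lambda>U V x. snd U x * snd V x + weighted_deriv \<theta> (fst U) x * weighted_deriv \<theta> (fst V) x"
  note int = state_inner_integrable[OF U U] state_inner_integrable[OF U V] state_inner_integrable[OF V V]
  have W: "?W \<in> state_space \<theta>" using U V by (rule state_space_linear_combination)
  have "AE x in ?I. weighted_deriv \<theta> (fst ?W) x = p * weighted_deriv \<theta> (fst U) x + q * weighted_deriv \<theta> (fst V) x"
    unfolding state_linear_combination fst_conv
    using U V by (intro AE_weighted_deriv_linear_combination) (auto simp: state_space_def)
  then have "AE x in ?I. ?b ?W ?W x = p\<^sup>2 * ?b U U x + 2 * p * q * ?b U V x + q\<^sup>2 * ?b V V x"
  proof eventually_elim
    case (elim x)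
    have "snd ?W x = p * snd U x + q * snd V x" by (simp add: state_linear_combination)
    then show ?case unfolding elim by (simp add: power2_eq_square algebra_simps)
  qed
  then have "state_inner \<theta> ?W ?W = (LINT x|?I. p\<^sup>2 * ?b U U x + 2 * p * q * ?b U V x + q\<^sup>2 * ?b V V x)"
    unfolding state_inner_eq
    by (intro integral_cong_AE borel_measurable_integrable Bochner_Integration.integrable_add
        integrable_mult_right int state_inner_integrable[OF W W])
  also have "\<dots> = p\<^sup>2 * state_inner \<theta> U U + 2 * p * q * state_inner \<theta> U V + q\<^sup>2 * state_inner \<theta> V V"
    unfolding state_inner_eq using int by (simp add: Bochner_Integration.integral_add)
  finally show ?thesis .
qed

lemma state_norm_scaleR:
  assumes "U \<in> state_space \<theta>"
  shows "state_norm \<theta> (p *\<^sub>R U) = \<bar>p\<bar> * state_norm \<theta> U"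
  using state_inner_linear_combination[OF assms assms, of p 0]
  by (simp add: state_norm_def real_sqrt_mult)

text \<open>
  The Cauchy-Schwarz inequality for the state inner product, from the nonnegativity of the quadratic
  form \<open>(p, q) \<mapsto> \<langle>p U + q V, p U + q V\<rangle>\<close>.
\<close>

lemma state_norm_triangle:
  assumes U: "U \<in> state_space \<theta>" and V: "V \<in> state_space \<theta>"
  shows "state_norm \<theta> (U + V) \<le> state_norm \<theta> U + state_norm \<theta> V"
proof -
  define a b c where "a = state_inner \<theta> U U" and "b = state_inner \<theta> U V" and "c = state_inner \<theta> V V"
  have quad: "0 \<le> p\<^sup>2 * a + 2 * p * q * b + q\<^sup>2 * c" for p q
    using state_inner_linear_combination[OF U V, of p q] state_inner_nonneg[of \<theta> "p *\<^sub>R U + q *\<^sub>R V"]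
    by (simp add: a_def b_def c_def)
  have a: "a \<ge> 0" and c: "c \<ge> 0"
    by (auto simp: a_def c_def state_inner_nonneg)
  have "b\<^sup>2 \<le> a * c"
  proof (cases "c = 0")
    case True
    have "b = 0"
    proof (rule ccontr)
      assume "b \<noteq> 0"
      \<comment> \<open>For this second coefficient the quadratic form takes the value \<open>-1\<close>.\<close>
      then show False using quad[of 1 "- (a + 1) / (2 * b)"] True by (simp add: field_simps)
    qed
    then show ?thesis using a c by simp
  next
    case False
    have "0 \<le> c * (a * c - b\<^sup>2)"
      using quad[of c "- b"] by (simp add: power2_eq_square algebra_simps)
    then show ?thesis using False c by (simp add: zero_le_mult_iff)
  qed
  then have "b \<le> sqrt a * sqrt c"
    by (metis real_le_rsqrt real_sqrt_mult)
  moreover have "state_inner \<theta> (U + V) (U + V) = a + 2 * b + c"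
    using state_inner_linear_combination[OF U V, of 1 1] by (simp add: a_def b_def c_def)
  moreover have "a + 2 * (sqrt a * sqrt c) + c = (sqrt a + sqrt c)\<^sup>2"
    using a c by (simp add: power2_sum)
  ultimately have "state_inner \<theta> (U + V) (U + V) \<le> (sqrt a + sqrt c)\<^sup>2" by linarith
  then show ?thesis
    unfolding state_norm_def a_def c_def
    by (intro real_le_lsqrt add_nonneg_nonneg) (auto simp: state_inner_nonneg)
qed

text \<open>
  The norm sees the position only through its derivative.  The boundary condition at \<open>1\<close> and absolute
  continuity turn a null position into one that vanishes at every point of \<open>]0, 1]\<close>, so that the
  boundary trace of a solution does not depend on the choice of the representative.
\<close>

lemma position_zero_if_state_norm_zero:
  assumes W: "W \<in> state_space \<theta>" and N: "state_norm \<theta> W = 0" and x: "0 < x" "x \<le> 1"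
  shows "fst W x = 0"
proof (cases "x = 1")
  case True
  then show ?thesis using W by (auto simp: state_space_def H1a_def)
next
  case False
  let ?I = "lebesgue_on {0<..<1::real}"
  have H: "fst W \<in> H1a \<theta>" using W by (auto simp: state_space_def)
  have "(LINT x|?I. snd W x * snd W x + weighted_deriv \<theta> (fst W) x * weighted_deriv \<theta> (fst W) x) = 0"
    using N by (simp add: state_norm_def state_inner_eq)
  then have "AE x in ?I. snd W x * snd W x + weighted_deriv \<theta> (fst W) x * weighted_deriv \<theta> (fst W) x = 0"
    by (subst (asm) integral_nonneg_eq_0_iff_AE[OF state_inner_integrable[OF W W]]) auto
  moreover have "AE x in ?I. fst W differentiable (at x)" using H by (auto simp: H1a_def)
  moreover have "AE x in ?I. x > 0" by (rule AE_I2) auto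
  ultimately have "AE x in ?I. (fst W has_real_derivative 0) (at x)"
  proof eventually_elim
    case (elim x)
    then have "weighted_deriv \<theta> (fst W) x = 0" by (simp add: add_nonneg_eq_0_iff)
    then have "deriv (fst W) x = 0" using elim by (simp add: weighted_deriv_def)
    moreover have "(fst W has_real_derivative deriv (fst W) x) (at x)"
      using elim by (simp add: DERIV_deriv_iff_real_differentiable)
    ultimately show ?case by simp
  qed
  then have "AE x in lebesgue. x \<in> {0<..<1} \<longrightarrow> (fst W has_real_derivative 0) (at x)"
    by (simp add: AE_restrict_space_iff)
  then obtain E where E: "{x. \<not> (x \<in> {0<..<1} \<longrightarrow> (fst W has_real_derivative 0) (at x))} \<subseteq> E"
      "E \<in> null_sets lebesgue"
    by (auto simp: eventually_ae_filter)
  have "fst W 1 = fst W x"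
  proof (rule abs_continuous_const_if_deriv_zero_ae[where f = "fst W" and E = E])
    show "abs_continuous x 1 (fst W)" using H x False by (simp add: H1a_def)
    show "negligible E" using E(2) negligible_iff_null_sets by blast
    show "(fst W has_real_derivative 0) (at y)" if "y \<in> {x<..<1} - E" for y
      using that subsetD[OF E(1), of y] x by auto
  qed (use x in auto)
  then show ?thesis using H by (simp add: H1a_def)
qed

lemma state_norm_zero_if_vanishing:
  assumes "\<And>x. x \<in> {0<..<1} \<Longrightarrow> snd U x = 0" "\<And>x. x \<in> {0<..<1} \<Longrightarrow> deriv (fst U) x = 0"
  shows "state_norm \<theta> U = 0"
proof -
  have "state_inner \<theta> U U = (LINT x|lebesgue_on {0<..<1::real}. 0)"
    unfolding state_inner_def by (rule Bochner_Integration.integral_cong) (use assms in auto)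
  then show ?thesis by (simp add: state_norm_def)
qed

lemma zero_mem_H2a: "(\<lambda>_. 0) \<in> H2a \<theta>"
proof -
  have L2: "(\<lambda>_. 0) \<in> L2 0 1"
    by (rule L2_if_continuous[of _ _ "\<lambda>_. 0"]) auto
  have AC: "abs_continuous a b (\<lambda>_. 0)" for a b
    by (rule abs_continuous_if_continuous_deriv[of _ _ _ "\<lambda>_. 0"]) auto
  have d: "deriv (\<lambda>_. 0::real) = (\<lambda>_. 0)" by (simp add: fun_eq_iff)
  have "(\<lambda>_. 0) \<in> H1" unfolding H1_def mem_Collect_eq
    by (intro exI[of _ "\<lambda>_. 0"]) (simp add: L2 AC d)
  moreover have "(\<lambda>_. 0) \<in> H1a \<theta>" by (simp add: H1a_def L2 AC d)
  ultimately show ?thesis by (simp add: H2a_def d)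
qed

section \<open>A power series of Bessel type and its zeros\<close>

text \<open>
  The entire function \<open>hyp \<mu>\<close> is the confluent hypergeometric limit function \<open>\<^sub>0F\<^sub>1(; \<mu>; - z)\<close>.  Up to
  a power of \<open>z\<close> and a constant it is the Bessel function of order \<open>\<mu> - 1\<close> at \<open>2 * sqrt z\<close>; the
  series has the advantage that it is regular at \<open>0\<close>, which is the degenerate endpoint.
\<close>

definition hyp_coeff :: "real \<Rightarrow> nat \<Rightarrow> real" where
  "hyp_coeff \<mu> k = (-1) ^ k / (fact k * pochhammer \<mu> k)"

definition hyp :: "real \<Rightarrow> real \<Rightarrow> real" where
  "hyp \<mu> z = (\<Sum>k. hyp_coeff \<mu> k * z ^ k)"

definition hyp' :: "real \<Rightarrow> real \<Rightarrow> real" where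
  "hyp' \<mu> z = (\<Sum>k. diffs (hyp_coeff \<mu>) k * z ^ k)"

lemma hyp_coeff_recurrence:
  assumes "\<mu> > 0"
  shows "(\<mu> + real k) * diffs (hyp_coeff \<mu>) k = - hyp_coeff \<mu> k"
proof -
  have cancel: "m * (n * (- s / (n * F * (P * m)))) = - (s / (F * P))"
    if "m > 0" "n > 0" for m n s F P :: real
    using that by simp
  show ?thesis
    using cancel[of "\<mu> + real k" "real (Suc k)" "(-1) ^ k" "fact k" "pochhammer \<mu> k"] assms
    by (simp add: diffs_def hyp_coeff_def pochhammer_Suc del: of_nat_Suc)
qed

lemma hyp_coeff_summable:
  assumes "\<mu> > 0"
  shows "summable (\<lambda>k. hyp_coeff \<mu> k * z ^ k)"
proof (cases "z = 0")
  case False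
  \<comment> \<open>Beyond this index the ratio of consecutive terms is at most one half.\<close>
  define N where "N = nat \<lceil>2 * \<bar>z\<bar> / \<mu>\<rceil>"
  show ?thesis
  proof (rule summable_ratio_test[of "1/2" N])
    fix k assume "k \<ge> N"
    have "2 * \<bar>z\<bar> / \<mu> \<le> real N" unfolding N_def by linarith
    then have "2 * \<bar>z\<bar> \<le> real k * \<mu>" using assms \<open>k \<ge> N\<close>
      by (smt (verit) divide_le_eq mult_right_mono of_nat_mono)
    also have "\<dots> \<le> real (Suc k) * (\<mu> + real k)" using assms by (intro mult_mono) auto
    finally have le: "2 * \<bar>z\<bar> \<le> real (Suc k) * (\<mu> + real k)" .
    have pos: "real (Suc k) * (\<mu> + real k) > 0" using assms by simp
    have "hyp_coeff \<mu> (Suc k) * (real (Suc k) * (\<mu> + real k)) = - hyp_coeff \<mu> k"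
      using hyp_coeff_recurrence[OF assms, of k] by (simp add: diffs_def mult_ac del: of_nat_Suc)
    then have "\<bar>hyp_coeff \<mu> (Suc k)\<bar> * (real (Suc k) * (\<mu> + real k)) = \<bar>hyp_coeff \<mu> k\<bar>"
      using pos by (metis abs_minus_cancel abs_mult abs_of_pos)
    then have "\<bar>hyp_coeff \<mu> (Suc k)\<bar> * (2 * \<bar>z\<bar>) \<le> \<bar>hyp_coeff \<mu> k\<bar>"
      using mult_left_mono[OF le, of "\<bar>hyp_coeff \<mu> (Suc k)\<bar>"] by simp
    then have "\<bar>hyp_coeff \<mu> (Suc k)\<bar> * (2 * \<bar>z\<bar>) * \<bar>z\<bar> ^ k \<le> \<bar>hyp_coeff \<mu> k\<bar> * \<bar>z\<bar> ^ k"
      by (intro mult_right_mono) auto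
    then show "norm (hyp_coeff \<mu> (Suc k) * z ^ Suc k) \<le> 1/2 * norm (hyp_coeff \<mu> k * z ^ k)"
      by (simp add: abs_mult power_abs mult_ac)
  qed simp
qed (simp add: summable_zero_power')

lemma hyp_coeff_diffs_summable:
  assumes "\<mu> > 0"
  shows "summable (\<lambda>k. diffs (hyp_coeff \<mu>) k * z ^ k)"
  using termdiff_converges_all[OF hyp_coeff_summable[OF assms], of z] .

lemma hyp_has_real_derivative:
  assumes "\<mu> > 0"
  shows "(hyp \<mu> has_real_derivative hyp' \<mu> z) (at z)"
proof -
  have "((\<lambda>z. \<Sum>k. hyp_coeff \<mu> k * z ^ k) has_real_derivative hyp' \<mu> z) (at z)"
    unfolding hyp'_def
    by (rule termdiffs_strong_converges_everywhere[OF hyp_coeff_summable[OF assms]])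
  then show ?thesis by (simp add: hyp_def[abs_def])
qed

text \<open>
  The series solves \<open>z f'' + \<mu> f' + f = 0\<close>, by comparison of coefficients with the recurrence.
\<close>

lemma hyp'_has_real_derivative:
  assumes "\<mu> > 0"
  obtains d where "(hyp' \<mu> has_real_derivative d) (at z)" "z * d + \<mu> * hyp' \<mu> z = - hyp \<mu> z"
proof -
  let ?c = "hyp_coeff \<mu>"
  define d where "d = (\<Sum>k. diffs (diffs ?c) k * z ^ k)"
  have "((\<lambda>z. \<Sum>k. diffs ?c k * z ^ k) has_real_derivative d) (at z)"
    unfolding d_def
    by (rule termdiffs_strong_converges_everywhere[OF hyp_coeff_diffs_summable[OF assms]])
  then have der: "(hyp' \<mu> has_real_derivative d) (at z)" by (simp add: hyp'_def[abs_def])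
  have s2: "summable (\<lambda>k. diffs (diffs ?c) k * z ^ k)"
    using termdiff_converges_all[OF hyp_coeff_diffs_summable[OF assms], of z] .
  have "(\<lambda>k. diffs (diffs ?c) k * z ^ k * z) sums (d * z)"
    unfolding d_def by (intro sums_mult2 summable_sums s2)
  then have "(\<lambda>k. real (Suc k) * diffs ?c (Suc k) * z ^ Suc k) sums (d * z)"
    by (simp add: diffs_def mult_ac)
  then have A: "(\<lambda>k. real k * diffs ?c k * z ^ k) sums (d * z)"
    using sums_Suc_iff[of "\<lambda>k. real k * diffs ?c k * z ^ k" "d * z"] by simp
  have B: "(\<lambda>k. \<mu> * (diffs ?c k * z ^ k)) sums (\<mu> * hyp' \<mu> z)"
    unfolding hyp'_def by (intro sums_mult summable_sums hyp_coeff_diffs_summable assms)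
  have "(\<lambda>k. real k * diffs ?c k * z ^ k + \<mu> * (diffs ?c k * z ^ k)) sums (d * z + \<mu> * hyp' \<mu> z)"
    by (rule sums_add[OF A B])
  moreover have "real k * diffs ?c k * z ^ k + \<mu> * (diffs ?c k * z ^ k) = - (?c k * z ^ k)" for k
  proof -
    have "real k * diffs ?c k * z ^ k + \<mu> * (diffs ?c k * z ^ k) = ((\<mu> + real k) * diffs ?c k) * z ^ k"
      by (simp add: algebra_simps)
    then show ?thesis by (simp add: hyp_coeff_recurrence[OF assms])
  qed
  ultimately have "(\<lambda>k. - (?c k * z ^ k)) sums (d * z + \<mu> * hyp' \<mu> z)" by simp
  moreover have "(\<lambda>k. - (?c k * z ^ k)) sums (- hyp \<mu> z)"
    unfolding hyp_def by (intro sums_minus summable_sums hyp_coeff_summable assms)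
  ultimately have "d * z + \<mu> * hyp' \<mu> z = - hyp \<mu> z" by (rule sums_unique2)
  then show ?thesis using der that by (simp add: mult.commute)
qed

lemma hyp_0: "hyp \<mu> 0 = 1"
  by (simp add: hyp_def powser_zero) (simp add: hyp_coeff_def)

lemma continuous_on_hyp: "\<mu> > 0 \<Longrightarrow> continuous_on A (hyp \<mu>)"
  by (meson DERIV_isCont continuous_at_imp_continuous_on hyp_has_real_derivative)

lemma continuous_on_hyp': "\<mu> > 0 \<Longrightarrow> continuous_on A (hyp' \<mu>)"
  by (meson DERIV_isCont continuous_at_imp_continuous_on hyp'_has_real_derivative)

text \<open>
  Suppose that \<open>f = hyp \<mu>\<close> has no zero and hence is positive.  Test the self-adjoint form
  \<open>(z\<^sup>\<mu> f')' = - z\<^bsup>\<mu> - 1\<^esup> f\<close> of the equation against \<open>p(z) = (Z - z)\<^sup>2\<close>, which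
  vanishes to second order at \<open>Z\<close>: the Wronskian \<open>G = z\<^sup>\<mu> (f' p - f p')\<close> vanishes at \<open>0\<close> and
  at \<open>Z\<close>, while \<open>G' = - z\<^bsup>\<mu> - 1\<^esup> f (p + \<mu> p' + z p'')\<close>.  The last factor is a quadratic
  polynomial in \<open>Z - z\<close> with negative discriminant as soon as \<open>2 Z > (\<mu> + 1)\<^sup>2\<close>, so \<open>G\<close> is
  strictly decreasing, a contradiction.
\<close>

lemma hyp_has_positive_zero:
  assumes "\<mu> > 0"
  obtains c where "c > 0" "hyp \<mu> c = 0"
proof (rule ccontr)
  assume "\<not> thesis"
  then have nz: "hyp \<mu> z \<noteq> 0" if "z > 0" for z using that \<open>\<And>c. \<lbrakk>c > 0; hyp \<mu> c = 0\<rbrakk> \<Longrightarrow> thesis\<close> by blast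
  have pos: "hyp \<mu> z > 0" if "z \<ge> 0" for z
  proof (rule ccontr)
    assume "\<not> hyp \<mu> z > 0"
    then obtain w where "0 \<le> w" "hyp \<mu> w = 0"
      using IVT2'[OF _ _ \<open>z \<ge> 0\<close> continuous_on_hyp[OF assms], of 0] by (auto simp: hyp_0)
    then show False using nz[of w] by (cases "w = 0") (auto simp: hyp_0)
  qed
  define Z where "Z = (\<mu> + 1)\<^sup>2"
  have "Z > 0" using assms by (simp add: Z_def)
  define G where "G z = z powr \<mu> * (hyp' \<mu> z * (Z - z)\<^sup>2 + 2 * (Z - z) * hyp \<mu> z)" for z
  define G' where "G' z = - (z powr (\<mu> - 1)) * hyp \<mu> z * ((Z - z)\<^sup>2 - 2 * (\<mu> + 1) * (Z - z) + 2 * Z)" for z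
  have der: "(G has_real_derivative G' z) (at z)" if "0 < z" for z
  proof -
    obtain d where d: "(hyp' \<mu> has_real_derivative d) (at z)" "z * d + \<mu> * hyp' \<mu> z = - hyp \<mu> z"
      using hyp'_has_real_derivative[OF assms] by blast
    have zp: "z powr \<mu> = z * z powr (\<mu> - 1)" using that by (simp add: powr_diff)
    have inner: "((\<lambda>z. hyp' \<mu> z * (Z - z)\<^sup>2 + 2 * (Z - z) * hyp \<mu> z) has_real_derivative
        d * (Z - z)\<^sup>2 - 2 * (Z - z) * hyp' \<mu> z + (2 * (Z - z) * hyp' \<mu> z - 2 * hyp \<mu> z)) (at z)"
      by (auto intro!: derivative_eq_intros d(1) hyp_has_real_derivative[OF assms] simp: algebra_simps)
    have "(G has_real_derivative
        (\<mu> * z powr (\<mu> - 1)) * (hyp' \<mu> z * (Z - z)\<^sup>2 + 2 * (Z - z) * hyp \<mu> z)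
        + z powr \<mu> * (d * (Z - z)\<^sup>2 - 2 * (Z - z) * hyp' \<mu> z + (2 * (Z - z) * hyp' \<mu> z - 2 * hyp \<mu> z))) (at z)"
      unfolding G_def using DERIV_mult[OF has_real_derivative_powr[OF that, of \<mu>] inner]
      by (simp add: mult.commute add.commute)
    moreover have "(\<mu> * z powr (\<mu> - 1)) * (hyp' \<mu> z * (Z - z)\<^sup>2 + 2 * (Z - z) * hyp \<mu> z)
        + z powr \<mu> * (d * (Z - z)\<^sup>2 - 2 * (Z - z) * hyp' \<mu> z + (2 * (Z - z) * hyp' \<mu> z - 2 * hyp \<mu> z))
      = z powr (\<mu> - 1) * ((z * d + \<mu> * hyp' \<mu> z) * (Z - z)\<^sup>2 + hyp \<mu> z * (2 * \<mu> * (Z - z) - 2 * z))"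
      unfolding zp by (simp add: algebra_simps power2_eq_square)
    moreover have "\<dots> = G' z"
      unfolding d(2) G'_def by (simp add: algebra_simps power2_eq_square)
    ultimately show ?thesis by simp
  qed
  have cont: "continuous_on {0..Z} G"
    unfolding G_def using assms
    by (intro continuous_intros continuous_on_powr' continuous_on_hyp continuous_on_hyp') auto
  obtain l z where z: "0 < z" "z < Z" "(G has_real_derivative l) (at z)" "G Z - G 0 = (Z - 0) * l"
    using MVT[OF \<open>Z > 0\<close> cont] der real_differentiable_def by blast
  have "l = G' z" using DERIV_unique[OF z(3) der[OF z(1)]] .
  moreover have "G Z = 0" "G 0 = 0" using assms by (auto simp: G_def)
  ultimately have "G' z = 0" using z(4) \<open>Z > 0\<close> by simp
  moreover have "(Z - z)\<^sup>2 - 2 * (\<mu> + 1) * (Z - z) + 2 * Z > 0"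
  proof -
    have "(Z - z)\<^sup>2 - 2 * (\<mu> + 1) * (Z - z) + 2 * Z = ((Z - z) - (\<mu> + 1))\<^sup>2 + Z"
      by (simp add: Z_def power2_eq_square algebra_simps)
    then show ?thesis using \<open>Z > 0\<close> by (smt (verit) zero_le_power2)
  qed
  moreover have "hyp \<mu> z > 0" using pos z by simp
  ultimately show False using z(1) by (simp add: G'_def)
qed

section \<open>Contraction semigroups on an invariant plane\<close>

text \<open>
  Elements are representatives and not classes, so a null vector need not be \<open>0\<close>
  and only a seminorm is available.
\<close>

locale seminormed_space =
  fixes C :: "'a::real_vector set" and N :: "'a \<Rightarrow> real"
  assumes linear_combination: "\<lbrakk>x \<in> C; y \<in> C\<rbrakk> \<Longrightarrow> a *\<^sub>R x + b *\<^sub>R y \<in> C"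
    and triangle: "\<lbrakk>x \<in> C; y \<in> C\<rbrakk> \<Longrightarrow> N (x + y) \<le> N x + N y"
    and homogeneous: "x \<in> C \<Longrightarrow> N (a *\<^sub>R x) = \<bar>a\<bar> * N x"
begin

lemma scaleR_mem: "x \<in> C \<Longrightarrow> a *\<^sub>R x \<in> C"
  using linear_combination[of x x a 0] by simp

lemma diff_mem: "\<lbrakk>x \<in> C; y \<in> C\<rbrakk> \<Longrightarrow> x - y \<in> C"
  using linear_combination[of x y 1 "-1"] by simp

lemma minus_commute: "\<lbrakk>x \<in> C; y \<in> C\<rbrakk> \<Longrightarrow> N (x - y) = N (y - x)"
  using homogeneous[OF diff_mem, of x y "-1"] by simp

lemma diff_triangle: "\<lbrakk>x \<in> C; y \<in> C; z \<in> C\<rbrakk> \<Longrightarrow> N (x - z) \<le> N (x - y) + N (y - z)"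
  using triangle[OF diff_mem diff_mem, of x y y z] by simp

lemma diff_le: "\<lbrakk>x \<in> C; y \<in> C\<rbrakk> \<Longrightarrow> N (x - y) \<le> N x + N y"
  using triangle[of x "(-1) *\<^sub>R y"] homogeneous[of y "-1"] scaleR_mem[of y "-1"] by simp

lemma nonneg: "x \<in> C \<Longrightarrow> 0 \<le> N x"
  using diff_le[of x x] homogeneous[of x 0] by simp

lemma eq_if_diff_null:
  assumes "x \<in> C" "y \<in> C" "N (x - y) = 0"
  shows "N x = N y"
proof -
  have "N x \<le> N (x - y) + N y" "N y \<le> N (y - x) + N x"
    using triangle[OF diff_mem, of x y y] triangle[OF diff_mem, of y x x] assms by auto
  then show ?thesis using assms minus_commute[of x y] by simp
qed

text \<open>
  Uniqueness for the Cauchy problem.  Split \<open>[0, t]\<close> into \<open>n\<close> steps of length \<open>h\<close>.  One step of the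
  semigroup starting on the curve \<open>U\<close> misses the curve by at most \<open>e * h\<close>, and by contraction the
  error made in earlier steps does not grow.  The total error is at most \<open>n * (e * h) = e * t\<close>.
\<close>

lemma approximate_solution_eq_semigroup:
  assumes S: "contraction_semigroup C N S"
    and U: "\<And>s. U s \<in> C"
    and approx: "\<And>e. e > 0 \<Longrightarrow> \<exists>d>0. \<forall>h s. 0 < h \<and> h < d \<longrightarrow> N (S h (U s) - U (s + h)) \<le> e * h"
    and "t \<ge> 0"
  shows "N (S t (U 0) - U t) = 0"
proof -
  have SC: "S r x \<in> C" if "r \<ge> 0" "x \<in> C" for r x
    using S that unfolding contraction_semigroup_def by blast
  have S0: "N (S 0 x - x) = 0" if "x \<in> C" for x
    using S that unfolding contraction_semigroup_def by blast
  have Sadd: "N (S (r + q) x - S r (S q x)) = 0" if "r \<ge> 0" "q \<ge> 0" "x \<in> C" for r q x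
    using S that unfolding contraction_semigroup_def by blast
  have Slin: "N (S r (a *\<^sub>R x + b *\<^sub>R y) - (a *\<^sub>R S r x + b *\<^sub>R S r y)) = 0"
    if "r \<ge> 0" "x \<in> C" "y \<in> C" for r a b x y
    using S that unfolding contraction_semigroup_def by blast
  have Scontr: "N (S r x) \<le> N x" if "r \<ge> 0" "x \<in> C" for r x
    using S that unfolding contraction_semigroup_def by blast
  have Sdiff: "N (S r x - S r y) \<le> N (x - y)" if "r \<ge> 0" "x \<in> C" "y \<in> C" for r x y
  proof -
    have "N (S r (x - y) - (S r x - S r y)) = 0"
      using Slin[OF that, of 1 "-1"] by simp
    then have "N (S r (x - y)) = N (S r x - S r y)"
      using that by (intro eq_if_diff_null) (auto intro: SC diff_mem)
    then show ?thesis using Scontr[of r "x - y"] that diff_mem by simp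
  qed
  have step: "N (S (real n * h) (U 0) - U (real n * h)) \<le> real n * (e * h)"
    if "h > 0" and h: "\<And>s. N (S h (U s) - U (s + h)) \<le> e * h" for e h n
  proof (induction n)
    case 0
    show ?case using S0[OF U[of 0]] by simp
  next
    case (Suc n)
    define r where "r = real n * h"
    have r: "r \<ge> 0" "real (Suc n) * h = h + r" using \<open>h > 0\<close> by (auto simp: r_def algebra_simps)
    have mem: "S (h + r) (U 0) \<in> C" "S h (S r (U 0)) \<in> C" "S h (U r) \<in> C" "S r (U 0) \<in> C"
      using r \<open>h > 0\<close> U by (auto intro!: SC)
    have "N (S (h + r) (U 0) - U (h + r))
        \<le> N (S (h + r) (U 0) - S h (S r (U 0))) + N (S h (S r (U 0)) - U (h + r))"
      by (intro diff_triangle mem U)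
    also have "\<dots> \<le> 0 + (N (S h (S r (U 0)) - S h (U r)) + N (S h (U r) - U (h + r)))"
      using Sadd[of h r "U 0"] r \<open>h > 0\<close> U by (intro add_mono diff_triangle mem U) auto
    also have "\<dots> \<le> 0 + (N (S r (U 0) - U r) + e * h)"
      using h[of r] Sdiff[OF _ mem(4) U, of h r] \<open>h > 0\<close> by (simp add: add.commute)
    also have "\<dots> \<le> real (Suc n) * (e * h)"
      using Suc.IH by (simp add: r_def algebra_simps)
    finally show ?case unfolding r(2) by simp
  qed
  have le: "N (S t (U 0) - U t) \<le> e * t" if "e > 0" for e
  proof (cases "t = 0")
    case True
    then show ?thesis using S0[OF U[of 0]] by simp
  next
    case False
    then have "t > 0" using \<open>t \<ge> 0\<close> by simp
    obtain d where d: "d > 0" "\<And>h s. 0 < h \<and> h < d \<Longrightarrow> N (S h (U s) - U (s + h)) \<le> e * h"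
      using approx[OF \<open>e > 0\<close>] by blast
    obtain n where n: "t / d < real n" using reals_Archimedean2 by blast
    have "n > 0" using n \<open>t > 0\<close> d(1) by (metis divide_pos_pos gr0I less_asym of_nat_0)
    define h where "h = t / real n"
    have "0 < h" "h < d" "real n * h = t"
      using n \<open>n > 0\<close> \<open>t > 0\<close> d(1) by (auto simp: h_def field_simps)
    then show ?thesis using step[of h e n] d(2) by (metis mult.left_commute)
  qed
  have "N (S t (U 0) - U t) \<le> 0"
  proof (rule field_le_epsilon)
    fix e :: real assume "e > 0"
    have "N (S t (U 0) - U t) \<le> e / (t + 1) * t" using le[of "e / (t + 1)"] \<open>e > 0\<close> \<open>t \<ge> 0\<close> by simp
    also have "\<dots> \<le> e" using \<open>e > 0\<close> \<open>t \<ge> 0\<close> by (simp add: field_simps)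
    finally show "N (S t (U 0) - U t) \<le> 0 + e" by simp
  qed
  moreover have "S t (U 0) - U t \<in> C" using U SC \<open>t \<ge> 0\<close> diff_mem by blast
  ultimately show ?thesis using nonneg by (simp add: antisym)
qed

text \<open>
  A curve in the plane of \<open>E1\<close> and \<open>E2\<close> that starts at \<open>x\<close> with the velocity prescribed by the
  generator agrees with the orbit of \<open>x\<close> to first order.
\<close>

lemma generator_first_order:
  assumes S: "contraction_semigroup C N S"
    and gen: "(x, y) \<in> semigroup_generator C N S"
    and E: "E1 \<in> C" "E2 \<in> C"
    and V: "\<And>h. V h = f h *\<^sub>R E1 + g h *\<^sub>R E2" "V 0 = x" "p *\<^sub>R E1 + q *\<^sub>R E2 = y"
    and f: "(f has_real_derivative p) (at 0)" and g: "(g has_real_derivative q) (at 0)"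
  shows "((\<lambda>h. N (S h x - V h) / h) \<longlongrightarrow> 0) (at_right 0)"
proof -
  have xy: "x \<in> C" "y \<in> C" and lim: "((\<lambda>h. N ((S h x - x) /\<^sub>R h - y)) \<longlongrightarrow> 0) (at_right 0)"
    using gen by (auto simp: semigroup_generator_def)
  have f0: "((\<lambda>h. (f h - f 0) / h - p) \<longlongrightarrow> 0) (at_right 0)"
    using f by (intro LIM_zero) (auto simp: DERIV_def intro: filterlim_at_split[THEN iffD1, THEN conjunct2])
  have g0: "((\<lambda>h. (g h - g 0) / h - q) \<longlongrightarrow> 0) (at_right 0)"
    using g by (intro LIM_zero) (auto simp: DERIV_def intro: filterlim_at_split[THEN iffD1, THEN conjunct2])
  have bound: "((\<lambda>h. N ((S h x - x) /\<^sub>R h - y) + (\<bar>(f h - f 0) / h - p\<bar> * N E1 + \<bar>(g h - g 0) / h - q\<bar> * N E2))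
      \<longlongrightarrow> 0 + (\<bar>0\<bar> * N E1 + \<bar>0\<bar> * N E2)) (at_right 0)"
    by (intro tendsto_intros lim f0 g0)
  show ?thesis
  proof (rule tendsto_sandwich[of "\<lambda>_. 0"])
    show "eventually (\<lambda>h. N (S h x - V h) / h
        \<le> N ((S h x - x) /\<^sub>R h - y) + (\<bar>(f h - f 0) / h - p\<bar> * N E1 + \<bar>(g h - g 0) / h - q\<bar> * N E2)) (at_right 0)"
      using eventually_at_right_less[of 0]
    proof eventually_elim
      case (elim h)
      have SC: "S h x \<in> C"
        using S xy elim unfolding contraction_semigroup_def by simp
      have A: "(S h x - x) /\<^sub>R h - y \<in> C" by (intro diff_mem scaleR_mem SC xy)
      let ?B = "((f h - f 0) / h - p) *\<^sub>R E1 + ((g h - g 0) / h - q) *\<^sub>R E2"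
      have "(V h - x) /\<^sub>R h - y = ?B"
        unfolding V(2)[symmetric] V(3)[symmetric] V(1)
        by (simp add: algebra_simps divide_inverse)
      moreover have "(S h x - V h) /\<^sub>R h = ((S h x - x) /\<^sub>R h - y) - ((V h - x) /\<^sub>R h - y)"
        by (simp add: algebra_simps)
      ultimately have eq: "(S h x - V h) /\<^sub>R h = ((S h x - x) /\<^sub>R h - y) - ?B" by simp
      have "S h x - V h \<in> C" unfolding V(1) by (intro diff_mem linear_combination SC E)
      then have "N (S h x - V h) / h = N ((S h x - V h) /\<^sub>R h)"
        using elim by (simp add: homogeneous divide_inverse)
      also have "\<dots> \<le> N ((S h x - x) /\<^sub>R h - y) + N ?B"
        unfolding eq by (intro diff_le A linear_combination E)
      also have "N ?B \<le> \<bar>(f h - f 0) / h - p\<bar> * N E1 + \<bar>(g h - g 0) / h - q\<bar> * N E2"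
        using triangle[OF scaleR_mem scaleR_mem, OF E] by (simp add: homogeneous E)
      finally show ?case by simp
    qed
    show "eventually (\<lambda>h. 0 \<le> N (S h x - V h) / h) (at_right 0)"
      using eventually_at_right_less[of 0]
    proof eventually_elim
      case (elim h)
      have "S h x \<in> C"
        using S xy elim unfolding contraction_semigroup_def by simp
      then have "S h x - V h \<in> C" unfolding V(1) by (intro diff_mem linear_combination E)
      then show ?case using elim nonneg by simp
    qed
  qed (use bound in simp_all)
qed

text \<open>
  The generator maps the plane of \<open>E1\<close> and \<open>E2\<close> into itself and acts on it as a rotation of frequency
  \<open>\<omega>\<close> up to scaling, so the semigroup is the matrix exponential there.  The uniform one-step
  estimate that the uniqueness lemma needs reduces by linearity to the orbits of \<open>E1\<close> and \<open>E2\<close> at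
  time \<open>0\<close>, because the coordinates \<open>\<alpha>\<close> and \<open>\<beta>\<close> of the curve are bounded.
\<close>

lemma semigroup_on_rotation_plane:
  assumes S: "contraction_semigroup C N S" and "\<omega> > 0"
    and gen1: "(E1, (- \<omega>\<^sup>2) *\<^sub>R E2) \<in> semigroup_generator C N S"
    and gen2: "(E2, E1) \<in> semigroup_generator C N S"
    and "t \<ge> 0"
  shows "N (S t (a *\<^sub>R E1 + b *\<^sub>R E2)
     - ((a * cos (\<omega> * t) + b / \<omega> * sin (\<omega> * t)) *\<^sub>R E1 + (b * cos (\<omega> * t) - a * \<omega> * sin (\<omega> * t)) *\<^sub>R E2)) = 0"
proof -
  have E: "E1 \<in> C" "E2 \<in> C" using gen2 by (auto simp: semigroup_generator_def)
  define \<alpha> where "\<alpha> s = a * cos (\<omega> * s) + b / \<omega> * sin (\<omega> * s)" for s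
  define \<beta> where "\<beta> s = b * cos (\<omega> * s) - a * \<omega> * sin (\<omega> * s)" for s
  define U where "U s = \<alpha> s *\<^sub>R E1 + \<beta> s *\<^sub>R E2" for s
  define V1 where "V1 h = cos (\<omega> * h) *\<^sub>R E1 + (- \<omega> * sin (\<omega> * h)) *\<^sub>R E2" for h
  define V2 where "V2 h = (sin (\<omega> * h) / \<omega>) *\<^sub>R E1 + cos (\<omega> * h) *\<^sub>R E2" for h
  have lim1: "((\<lambda>h. N (S h E1 - V1 h) / h) \<longlongrightarrow> 0) (at_right 0)"
  proof (rule generator_first_order[OF S gen1 E, where p = 0 and q = "- \<omega>\<^sup>2"])
    show "((\<lambda>h. cos (\<omega> * h)) has_real_derivative 0) (at 0)"
      by (auto intro!: derivative_eq_intros)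
    show "((\<lambda>h. - \<omega> * sin (\<omega> * h)) has_real_derivative - \<omega>\<^sup>2) (at 0)"
      by (auto intro!: derivative_eq_intros simp: power2_eq_square)
  qed (auto simp: V1_def)
  have lim2: "((\<lambda>h. N (S h E2 - V2 h) / h) \<longlongrightarrow> 0) (at_right 0)"
  proof (rule generator_first_order[OF S gen2 E, where p = 1 and q = 0])
    show "((\<lambda>h. sin (\<omega> * h) / \<omega>) has_real_derivative 1) (at 0)"
      using \<open>\<omega> > 0\<close> by (auto intro!: derivative_eq_intros)
    show "((\<lambda>h. cos (\<omega> * h)) has_real_derivative 0) (at 0)"
      by (auto intro!: derivative_eq_intros)
  qed (auto simp: V2_def)
  define M where "M = \<bar>a\<bar> + \<bar>b / \<omega>\<bar> + \<bar>b\<bar> + \<bar>a * \<omega>\<bar> + 1"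
  have "M > 0" unfolding M_def by (simp add: add_nonneg_pos)
  have \<alpha>M: "\<bar>\<alpha> s\<bar> \<le> M" and \<beta>M: "\<bar>\<beta> s\<bar> \<le> M" for s
  proof -
    have trig: "\<bar>x * cos y\<bar> \<le> \<bar>x\<bar>" "\<bar>x * sin y\<bar> \<le> \<bar>x\<bar>" for x y :: real
      by (simp_all add: abs_mult mult_left_le)
    show "\<bar>\<alpha> s\<bar> \<le> M" "\<bar>\<beta> s\<bar> \<le> M"
      using trig(1)[of a "\<omega> * s"] trig(2)[of "b / \<omega>" "\<omega> * s"] trig(1)[of b "\<omega> * s"] trig(2)[of "a * \<omega>" "\<omega> * s"]
      unfolding \<alpha>_def \<beta>_def M_def by linarith+
  qed
  have UC: "U s \<in> C" for s unfolding U_def by (intro linear_combination E)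
  have "N (S t (U 0) - U t) = 0"
  proof (rule approximate_solution_eq_semigroup[OF S UC _ \<open>t \<ge> 0\<close>])
    fix e :: real assume "e > 0"
    have "((\<lambda>h. M * (N (S h E1 - V1 h) / h) + M * (N (S h E2 - V2 h) / h)) \<longlongrightarrow> M * 0 + M * 0) (at_right 0)"
      by (intro tendsto_intros lim1 lim2)
    then have "eventually (\<lambda>h. M * (N (S h E1 - V1 h) / h) + M * (N (S h E2 - V2 h) / h) < e) (at_right 0)"
      by (rule order_tendstoD) (use \<open>e > 0\<close> in simp)
    then obtain d where d: "d > 0" "\<And>h. 0 < h \<Longrightarrow> h < d \<Longrightarrow>
        M * (N (S h E1 - V1 h) / h) + M * (N (S h E2 - V2 h) / h) < e"
      by (auto simp: eventually_at_right[of 0 1])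
    show "\<exists>d>0. \<forall>h s. 0 < h \<and> h < d \<longrightarrow> N (S h (U s) - U (s + h)) \<le> e * h"
    proof (intro exI[of _ d] conjI allI impI d(1))
      fix h s assume h: "0 < h \<and> h < d"
      let ?R1 = "S h E1 - V1 h" and ?R2 = "S h E2 - V2 h"
      have SC: "S h x \<in> C" if "x \<in> C" for x
        using S h that unfolding contraction_semigroup_def by simp
      have R: "?R1 \<in> C" "?R2 \<in> C"
        unfolding V1_def V2_def by (intro diff_mem linear_combination SC E)+
      let ?D = "S h (U s) - (\<alpha> s *\<^sub>R S h E1 + \<beta> s *\<^sub>R S h E2)"
      have D: "?D \<in> C" by (intro diff_mem linear_combination SC E UC)
      have "N ?D = 0"
        unfolding U_def using S E h unfolding contraction_semigroup_def by simp
      have \<alpha>': "\<alpha> (s + h) = \<alpha> s * cos (\<omega> * h) + \<beta> s * (sin (\<omega> * h) / \<omega>)"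
        using \<open>\<omega> > 0\<close> by (simp add: \<alpha>_def \<beta>_def distrib_left cos_add sin_add field_simps)
      have \<beta>': "\<beta> (s + h) = \<alpha> s * (- \<omega> * sin (\<omega> * h)) + \<beta> s * cos (\<omega> * h)"
        using \<open>\<omega> > 0\<close> by (simp add: \<alpha>_def \<beta>_def distrib_left cos_add sin_add field_simps)
      have "U (s + h) = \<alpha> s *\<^sub>R V1 h + \<beta> s *\<^sub>R V2 h"
        unfolding U_def V1_def V2_def \<alpha>' \<beta>' by (simp add: algebra_simps)
      then have "S h (U s) - U (s + h) = ?D + (\<alpha> s *\<^sub>R ?R1 + \<beta> s *\<^sub>R ?R2)"
        by (simp add: algebra_simps)
      then have "N (S h (U s) - U (s + h)) \<le> N ?D + N (\<alpha> s *\<^sub>R ?R1 + \<beta> s *\<^sub>R ?R2)"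
        using triangle[OF D linear_combination[OF R]] by metis
      also have "\<dots> \<le> 0 + (N (\<alpha> s *\<^sub>R ?R1) + N (\<beta> s *\<^sub>R ?R2))"
        unfolding \<open>N ?D = 0\<close> by (intro add_left_mono triangle scaleR_mem R)
      also have "\<dots> = \<bar>\<alpha> s\<bar> * N ?R1 + \<bar>\<beta> s\<bar> * N ?R2"
        by (simp add: homogeneous R)
      also have "\<dots> \<le> M * N ?R1 + M * N ?R2"
        using \<alpha>M \<beta>M nonneg R by (intro add_mono mult_right_mono) auto
      also have "\<dots> = (M * (N ?R1 / h) + M * (N ?R2 / h)) * h"
        using h by (simp add: field_simps)
      also have "\<dots> \<le> e * h"
        using d(2)[of h] h by (intro mult_right_mono) auto
      finally show "N (S h (U s) - U (s + h)) \<le> e * h" .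
    qed
  qed
  then show ?thesis by (simp add: U_def \<alpha>_def \<beta>_def)
qed

end

section \<open>An eigenfunction of the degenerate operator\<close>

text \<open>
  A positive zero \<open>c\<close> of the series yields the Dirichlet condition at \<open>1\<close> for the eigenfunction
  below, and with it an eigenvalue of \<open>- (x\<^sup>\<theta> u')'\<close>.
\<close>

locale degenerate_eigenvalue =
  fixes \<theta> c :: real
  assumes \<theta>: "1 \<le> \<theta>" "\<theta> < 2" and c: "c > 0" "hyp (1 / (2 - \<theta>)) c = 0"
begin

text \<open>
  With \<open>\<nu> = (\<theta> - 1) / (2 - \<theta>)\<close>, the eigenfunction \<open>\<Phi>\<close> is a multiple of
  \<open>x\<^bsup>(1 - \<theta>) / 2\<^esup> J\<^sub>\<nu>(2 \<surd>c x\<^bsup>(2 - \<theta>) / 2\<^esup>)\<close>, and \<open>lam\<close> is its eigenvalue.  The functions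
  \<open>flux\<close> and \<open>\<Phi>w\<close> are the continuous extensions to \<open>0\<close> of \<open>x\<^sup>\<theta> \<Phi>'\<close> and of
  \<open>x\<^bsup>\<theta> / 2\<^esup> \<Phi>'\<close>; they are written out in terms of the series because \<open>deriv\<close> says nothing
  about \<open>\<Phi>\<close> at the degenerate point.
\<close>

definition "\<Phi> x = hyp (1 / (2 - \<theta>)) (c * x powr (2 - \<theta>))"
definition "flux x = c * (2 - \<theta>) * x * hyp' (1 / (2 - \<theta>)) (c * x powr (2 - \<theta>))"
definition "lam = c * (2 - \<theta>)\<^sup>2"
definition "\<Phi>w x = c * (2 - \<theta>) * x powr (1 - \<theta> / 2) * hyp' (1 / (2 - \<theta>)) (c * x powr (2 - \<theta>))"

lemma \<mu>_pos: "1 / (2 - \<theta>) > 0" using \<theta> by simp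

lemma lam_pos: "lam > 0" using \<theta> c by (simp add: lam_def)

lemma continuous_on_powr_nonneg:
  assumes "p > 0" shows "continuous_on {0..} (\<lambda>x::real. x powr p)"
  using assms by (intro continuous_on_powr' continuous_intros) auto

lemma continuous_on_comp_hyp:
  "continuous_on {0..} (\<lambda>x. hyp (1 / (2 - \<theta>)) (c * x powr (2 - \<theta>)))"
  "continuous_on {0..} (\<lambda>x. hyp' (1 / (2 - \<theta>)) (c * x powr (2 - \<theta>)))"
  using \<theta> \<mu>_pos
  by (auto intro!: continuous_on_compose2[OF continuous_on_hyp[of _ UNIV]]
      continuous_on_compose2[OF continuous_on_hyp'[of _ UNIV]] continuous_intros continuous_on_powr_nonneg)

lemma continuous_on_\<Phi>: "continuous_on {0..} \<Phi>"
  unfolding \<Phi>_def[abs_def] by (rule continuous_on_comp_hyp)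

lemma continuous_on_flux: "continuous_on {0..} flux"
  unfolding flux_def[abs_def] by (intro continuous_intros continuous_on_comp_hyp)

lemma continuous_on_\<Phi>w: "continuous_on {0..} \<Phi>w"
  unfolding \<Phi>w_def[abs_def]
  using \<theta> by (intro continuous_intros continuous_on_comp_hyp continuous_on_powr_nonneg) auto

lemma DERIV_argument:
  assumes "x > 0"
  shows "((\<lambda>x. c * x powr (2 - \<theta>)) has_real_derivative c * (2 - \<theta>) * x powr (1 - \<theta>)) (at x)"
  using DERIV_cmult[OF has_real_derivative_powr[OF assms, of "2 - \<theta>"], of c]
  by (simp add: mult.assoc)

lemma DERIV_\<Phi>:
  assumes "x > 0"
  shows "(\<Phi> has_real_derivative x powr (- \<theta>) * flux x) (at x)"
proof -
  have "x powr (1 - \<theta>) = x * x powr (- \<theta>)"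
    using assms by (metis diff_conv_add_uminus powr_add powr_one less_imp_le)
  then show ?thesis
    using DERIV_chain2[OF hyp_has_real_derivative[OF \<mu>_pos] DERIV_argument[OF assms]]
    by (simp add: \<Phi>_def[abs_def] flux_def mult_ac)
qed

text \<open>
  This is the eigenvalue equation \<open>(x\<^sup>\<theta> \<Phi>')' = - lam \<Phi>\<close>.  In the variable \<open>z = c x\<^bsup>2 - \<theta>\<^esup>\<close> it is
  the equation \<open>z f'' + \<mu> f' + f = 0\<close> of the series with \<open>\<mu> = 1 / (2 - \<theta>)\<close>.
\<close>

lemma DERIV_flux:
  assumes "x > 0"
  shows "(flux has_real_derivative - lam * \<Phi> x) (at x)"
proof -
  let ?\<mu> = "1 / (2 - \<theta>)" and ?z = "c * x powr (2 - \<theta>)"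
  obtain d where d: "(hyp' ?\<mu> has_real_derivative d) (at ?z)"
      "?z * d + ?\<mu> * hyp' ?\<mu> ?z = - hyp ?\<mu> ?z"
    using hyp'_has_real_derivative[OF \<mu>_pos] by blast
  have "((\<lambda>x. hyp' ?\<mu> (c * x powr (2 - \<theta>))) has_real_derivative d * (c * (2 - \<theta>) * x powr (1 - \<theta>))) (at x)"
    by (rule DERIV_chain2[OF d(1) DERIV_argument[OF assms]])
  moreover have "((\<lambda>x. c * (2 - \<theta>) * x) has_real_derivative c * (2 - \<theta>)) (at x)"
    by (auto intro!: derivative_eq_intros)
  ultimately have "(flux has_real_derivative
      c * (2 - \<theta>) * hyp' ?\<mu> ?z + d * (c * (2 - \<theta>) * x powr (1 - \<theta>)) * (c * (2 - \<theta>) * x)) (at x)"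
    unfolding flux_def[abs_def] using DERIV_mult by blast
  moreover have "c * (2 - \<theta>) * hyp' ?\<mu> ?z + d * (c * (2 - \<theta>) * x powr (1 - \<theta>)) * (c * (2 - \<theta>) * x) = - lam * \<Phi> x"
  proof -
    have "x powr (2 - \<theta>) = x * x powr (1 - \<theta>)"
      using powr_add[of x 1 "1 - \<theta>"] assms by simp
    then have "d * (c * (2 - \<theta>) * x powr (1 - \<theta>)) * (c * (2 - \<theta>) * x) = lam * (?z * d)"
      by (simp add: lam_def power2_eq_square mult_ac)
    moreover have "c * (2 - \<theta>) * hyp' ?\<mu> ?z = lam * (?\<mu> * hyp' ?\<mu> ?z)"
      using \<theta> by (simp add: lam_def power2_eq_square)
    ultimately have "c * (2 - \<theta>) * hyp' ?\<mu> ?z + d * (c * (2 - \<theta>) * x powr (1 - \<theta>)) * (c * (2 - \<theta>) * x)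
        = lam * (?z * d + ?\<mu> * hyp' ?\<mu> ?z)"
      by (simp only: distrib_left add.commute)
    then show ?thesis unfolding d(2) by (simp add: \<Phi>_def)
  qed
  ultimately show ?thesis by simp
qed

lemma \<Phi>_0: "\<Phi> 0 = 1" by (simp add: \<Phi>_def hyp_0)

lemma \<Phi>_1: "\<Phi> 1 = 0" using c by (simp add: \<Phi>_def)

lemma deriv_\<Phi>: "x > 0 \<Longrightarrow> deriv \<Phi> x = x powr (- \<theta>) * flux x"
  by (intro DERIV_imp_deriv DERIV_\<Phi>)

lemma powr_deriv_\<Phi>: "x > 0 \<Longrightarrow> x powr \<theta> * deriv \<Phi> x = flux x"
  by (simp add: deriv_\<Phi> powr_minus)

lemma weighted_deriv_\<Phi>: "x > 0 \<Longrightarrow> weighted_deriv \<theta> \<Phi> x = \<Phi>w x"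
proof -
  assume x: "x > 0"
  have "x powr (\<theta> / 2) * x powr (- \<theta>) * x = x powr (1 - \<theta> / 2)"
    using powr_add[of x "\<theta> / 2" "- \<theta>"] powr_add[of x "- \<theta> / 2" 1] x by simp
  then show ?thesis
    using x by (simp add: weighted_deriv_def deriv_\<Phi> flux_def \<Phi>w_def mult_ac)
qed

lemma deriv_powr_deriv_\<Phi>:
  assumes "x > 0"
  shows "deriv (\<lambda>x. x powr \<theta> * deriv \<Phi> x) x = - lam * \<Phi> x"
proof (rule DERIV_imp_deriv)
  have "eventually (\<lambda>y. y > 0) (nhds x)" using eventually_nhds_in_open[of "{0<..}" x] assms by simp
  then have ev: "eventually (\<lambda>y. y powr \<theta> * deriv \<Phi> y = flux y) (nhds x)"
    by eventually_elim (rule powr_deriv_\<Phi>)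
  show "((\<lambda>x. x powr \<theta> * deriv \<Phi> x) has_real_derivative - lam * \<Phi> x) (at x)"
    unfolding DERIV_cong_ev[OF refl ev refl] by (rule DERIV_flux[OF assms])
qed

lemma \<Phi>_mem_H1a: "\<Phi> \<in> H1a \<theta>"
  unfolding H1a_def mem_Collect_eq
proof (intro conjI allI impI)
  show "\<Phi> \<in> L2 0 1"
    by (rule L2_if_continuous[of _ _ \<Phi>]) (auto intro: continuous_on_subset[OF continuous_on_\<Phi>])
  show "abs_continuous a 1 \<Phi>" if "0 < a \<and> a < 1" for a
  proof (rule abs_continuous_if_continuous_deriv)
    show "continuous_on {a..1} \<Phi>" "continuous_on {a..1} (\<lambda>x. x powr (- \<theta>) * flux x)"
      using that by (auto intro!: continuous_intros continuous_on_subset[OF continuous_on_\<Phi>]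
          continuous_on_subset[OF continuous_on_flux])
  qed (use that DERIV_\<Phi> in auto)
  show "AE x in lebesgue_on {0<..<1}. \<Phi> differentiable at x"
    using DERIV_\<Phi> by (intro AE_I2) (auto simp: real_differentiable_def)
  show "(\<lambda>x. x powr (\<theta> / 2) * deriv \<Phi> x) \<in> L2 0 1"
    by (rule L2_if_continuous[of _ _ \<Phi>w])
      (auto intro: continuous_on_subset[OF continuous_on_\<Phi>w] simp: weighted_deriv_\<Phi>[symmetric] weighted_deriv_def)
  show "\<Phi> 1 = 0" by (rule \<Phi>_1)
qed

lemma \<Phi>_mem_H2a: "\<Phi> \<in> H2a \<theta>"
proof -
  have "(\<lambda>x. x powr \<theta> * deriv \<Phi> x) \<in> H1"
    unfolding H1_def mem_Collect_eq
  proof (intro exI[of _ flux] conjI)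
    show "abs_continuous 0 1 flux"
    proof (rule abs_continuous_if_continuous_deriv)
      show "continuous_on {0..1} flux" "continuous_on {0..1} (\<lambda>x. - lam * \<Phi> x)"
        by (auto intro!: continuous_intros continuous_on_subset[OF continuous_on_\<Phi>]
            continuous_on_subset[OF continuous_on_flux])
    qed (use DERIV_flux in auto)
    show "AE x in lebesgue_on {0<..<1}. flux differentiable at x"
      using DERIV_flux by (intro AE_I2) (auto simp: real_differentiable_def)
    show "deriv flux \<in> L2 0 1"
    proof (rule L2_if_continuous)
      show "continuous_on {0..1} (\<lambda>x. - lam * \<Phi> x)"
        by (auto intro!: continuous_intros continuous_on_subset[OF continuous_on_\<Phi>])
    qed (use DERIV_flux in \<open>auto intro!: DERIV_imp_deriv\<close>)
    show "AE x in lebesgue_on {0<..<1}. x powr \<theta> * deriv \<Phi> x = flux x"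
      by (intro AE_I2) (auto simp: powr_deriv_\<Phi>)
  qed
  then show ?thesis using \<Phi>_mem_H1a by (simp add: H2a_def)
qed

text \<open>
  Testing the eigenvalue equation with \<open>\<Phi>\<close> gives the first identity, the equipartition of energy.
  Testing it with the multiplier \<open>x \<Phi>'\<close> gives
  \<open>\<Phi>'(1)\<^sup>2 = (1 - \<theta>) \<integral> x\<^sup>\<theta> \<Phi>'\<^sup>2 + lam \<integral> \<Phi>\<^sup>2\<close>, and the second identity follows from the first.  Each
  integrates the derivative of a function that vanishes at the degenerate endpoint, \<open>flux * \<Phi>\<close> and
  \<open>R\<close> respectively.
\<close>

lemma integral_identities:
  "integral {0..1} (\<lambda>x. (\<Phi>w x)\<^sup>2) = lam * integral {0..1} (\<lambda>x. (\<Phi> x)\<^sup>2)"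
  "(flux 1)\<^sup>2 = (2 - \<theta>) * integral {0..1} (\<lambda>x. (\<Phi>w x)\<^sup>2)"
  "integral {0..1} (\<lambda>x. (\<Phi> x)\<^sup>2) > 0"
proof -
  define I J where "I = integral {0..1} (\<lambda>x. (\<Phi>w x)\<^sup>2)" and "J = integral {0..1} (\<lambda>x. (\<Phi> x)\<^sup>2)"
  have cont: "continuous_on {0..1} \<Phi>" "continuous_on {0..1} flux" "continuous_on {0..1} \<Phi>w"
    using continuous_on_\<Phi> continuous_on_flux continuous_on_\<Phi>w by (auto intro: continuous_on_subset)
  have int: "((\<lambda>x. (\<Phi>w x)\<^sup>2) has_integral I) {0..1}" "((\<lambda>x. (\<Phi> x)\<^sup>2) has_integral J) {0..1}"
    unfolding I_def J_def
    by (intro integrable_integral integrable_continuous_real continuous_intros cont)+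
  have sq: "(\<Phi>w x)\<^sup>2 = x powr (- \<theta>) * (flux x)\<^sup>2" if "x > 0" for x
  proof -
    have "\<Phi>w x = x powr (\<theta> / 2) * x powr (- \<theta>) * flux x"
      using that by (simp add: weighted_deriv_\<Phi>[symmetric] weighted_deriv_def deriv_\<Phi>)
    then have "\<Phi>w x = x powr (- \<theta> / 2) * flux x" by (simp add: powr_add[symmetric])
    then show ?thesis by (simp add: power_mult_distrib power2_eq_square powr_add[symmetric])
  qed
  have ftc1: "((\<lambda>x. (\<Phi>w x)\<^sup>2 - lam * (\<Phi> x)\<^sup>2) has_integral (flux 1 * \<Phi> 1 - flux 0 * \<Phi> 0)) {0..1}"
  proof (rule fundamental_theorem_of_calculus_interior)
    show "continuous_on {0..1} (\<lambda>x. flux x * \<Phi> x)" by (intro continuous_intros cont)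
    fix x :: real assume "x \<in> {0<..<1}"
    then have "x > 0" by simp
    have "((\<lambda>x. flux x * \<Phi> x) has_real_derivative (- lam * \<Phi> x) * \<Phi> x + x powr (- \<theta>) * flux x * flux x) (at x)"
      by (rule DERIV_mult[OF DERIV_flux[OF \<open>x > 0\<close>] DERIV_\<Phi>[OF \<open>x > 0\<close>]])
    moreover have "(- lam * \<Phi> x) * \<Phi> x + x powr (- \<theta>) * flux x * flux x = (\<Phi>w x)\<^sup>2 - lam * (\<Phi> x)\<^sup>2"
      using sq[OF \<open>x > 0\<close>] by (simp add: power2_eq_square)
    ultimately show "((\<lambda>x. flux x * \<Phi> x) has_vector_derivative (\<Phi>w x)\<^sup>2 - lam * (\<Phi> x)\<^sup>2) (at x)"
      by (simp add: has_real_derivative_iff_has_vector_derivative)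
  qed simp
  have "((\<lambda>x. (\<Phi>w x)\<^sup>2 - lam * (\<Phi> x)\<^sup>2) has_integral I - lam * J) {0..1}"
    by (intro has_integral_diff has_integral_mult_right int)
  from has_integral_unique[OF ftc1 this] have IJ: "I = lam * J"
    by (simp add: \<Phi>_1 flux_def)
  then show "integral {0..1} (\<lambda>x. (\<Phi>w x)\<^sup>2) = lam * integral {0..1} (\<lambda>x. (\<Phi> x)\<^sup>2)"
    by (simp add: I_def J_def)
  define R where "R x = x * (\<Phi>w x)\<^sup>2 + lam * x * (\<Phi> x)\<^sup>2" for x
  have ftc2: "((\<lambda>x. (1 - \<theta>) * (\<Phi>w x)\<^sup>2 + lam * (\<Phi> x)\<^sup>2) has_integral (R 1 - R 0)) {0..1}"
  proof (rule fundamental_theorem_of_calculus_interior)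
    show "continuous_on {0..1} R" unfolding R_def[abs_def] by (intro continuous_intros cont)
    fix x :: real assume "x \<in> {0<..<1}"
    then have "x > 0" by simp
    have p: "y powr (1 - \<theta>) = y * y powr (- \<theta>)" if "y > 0" for y
      using powr_add[of y 1 "- \<theta>"] that by simp
    \<comment> \<open>For positive arguments the factor \<open>\<Phi>w\<close> of \<open>R\<close> is expressed by \<open>flux\<close>, whose derivative is known.\<close>
    let ?R = "\<lambda>y. y powr (1 - \<theta>) * (flux y * flux y) + lam * y * (\<Phi> y * \<Phi> y)"
    have ev: "eventually (\<lambda>y. R y = ?R y) (nhds x)"
    proof -
      have "eventually (\<lambda>y. y > 0) (nhds x)" using eventually_nhds_in_open[of "{0<..}" x] \<open>x > 0\<close> by simp
      then show ?thesis
        by eventually_elim (simp only: R_def sq p, simp add: power2_eq_square)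
    qed
    have "(?R has_real_derivative
        ((1 - \<theta>) * x powr (1 - \<theta> - 1) * (flux x * flux x)
          + ((- lam * \<Phi> x) * flux x + (- lam * \<Phi> x) * flux x) * x powr (1 - \<theta>))
        + (lam * (\<Phi> x * \<Phi> x)
          + (x powr (- \<theta>) * flux x * \<Phi> x + x powr (- \<theta>) * flux x * \<Phi> x) * (lam * x))) (at x)"
      by (intro DERIV_add DERIV_mult has_real_derivative_powr \<open>x > 0\<close> DERIV_flux DERIV_\<Phi>)
        (auto intro!: derivative_eq_intros)
    moreover have "((1 - \<theta>) * x powr (1 - \<theta> - 1) * (flux x * flux x)
          + ((- lam * \<Phi> x) * flux x + (- lam * \<Phi> x) * flux x) * x powr (1 - \<theta>))
        + (lam * (\<Phi> x * \<Phi> x)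
          + (x powr (- \<theta>) * flux x * \<Phi> x + x powr (- \<theta>) * flux x * \<Phi> x) * (lam * x))
        = (1 - \<theta>) * (\<Phi>w x)\<^sup>2 + lam * (\<Phi> x)\<^sup>2"
      unfolding sq[OF \<open>x > 0\<close>] p[OF \<open>x > 0\<close>] by (simp add: power2_eq_square algebra_simps)
    ultimately have "(?R has_real_derivative (1 - \<theta>) * (\<Phi>w x)\<^sup>2 + lam * (\<Phi> x)\<^sup>2) (at x)" by simp
    then have "(R has_real_derivative (1 - \<theta>) * (\<Phi>w x)\<^sup>2 + lam * (\<Phi> x)\<^sup>2) (at x)"
      unfolding DERIV_cong_ev[OF refl ev refl] .
    then show "(R has_vector_derivative (1 - \<theta>) * (\<Phi>w x)\<^sup>2 + lam * (\<Phi> x)\<^sup>2) (at x)"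
      by (simp add: has_real_derivative_iff_has_vector_derivative)
  qed simp
  have "((\<lambda>x. (1 - \<theta>) * (\<Phi>w x)\<^sup>2 + lam * (\<Phi> x)\<^sup>2) has_integral (1 - \<theta>) * I + lam * J) {0..1}"
    by (intro has_integral_add has_integral_mult_right int)
  from has_integral_unique[OF ftc2 this] have "(flux 1)\<^sup>2 = (1 - \<theta>) * I + lam * J"
    by (simp add: R_def \<Phi>_1 flux_def \<Phi>w_def)
  then show "(flux 1)\<^sup>2 = (2 - \<theta>) * integral {0..1} (\<lambda>x. (\<Phi>w x)\<^sup>2)"
    unfolding I_def[symmetric] using IJ by (simp add: algebra_simps)
  have "J \<noteq> 0"
  proof
    assume "J = 0"
    then have "\<forall>x\<in>{0..1}. (\<Phi> x)\<^sup>2 = 0"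
      using integral_eq_0_iff[of 0 1 "\<lambda>x. (\<Phi> x)\<^sup>2"] by (auto simp: J_def intro!: continuous_intros cont)
    then have "\<Phi> 0 = 0" by simp
    then show False by (simp add: \<Phi>_0)
  qed
  moreover have "J \<ge> 0" by (rule has_integral_nonneg[OF int(2)]) simp
  ultimately show "integral {0..1} (\<lambda>x. (\<Phi> x)\<^sup>2) > 0" by (simp add: J_def)
qed

end

section \<open>Standing waves and their observability quotients\<close>

lemma seminormed_state_space: "seminormed_space (state_space \<theta>) (state_norm \<theta>)"
  by unfold_locales (auto intro: state_space_linear_combination state_norm_triangle state_norm_scaleR)

lemma wave_domain_subset_state_space: "wave_domain \<theta> \<subseteq> state_space \<theta>"
  by (auto simp: wave_domain_def state_space_def H2a_def H1a_def)

lemma energy_at_0: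
  assumes S: "wave_semigroup \<theta> S" and U: "U \<in> state_space \<theta>"
  shows "energy \<theta> S U 0 = 1 / 2 * state_inner \<theta> U U"
proof -
  interpret seminormed_space "state_space \<theta>" "state_norm \<theta>" by (rule seminormed_state_space)
  have "S 0 U \<in> state_space \<theta>" "state_norm \<theta> (S 0 U - U) = 0"
    using S U by (auto simp: wave_semigroup_def contraction_semigroup_def)
  then have "state_norm \<theta> (S 0 U) = state_norm \<theta> U"
    using U eq_if_diff_null by blast
  then have "state_inner \<theta> (S 0 U) (S 0 U) = state_inner \<theta> U U"
    by (simp add: state_norm_def)
  moreover have "energy \<theta> S U 0 = 1 / 2 * state_inner \<theta> (S 0 U) (S 0 U)"
    by (simp add: energy_def state_inner_def mild_solution_def power2_eq_square mult.assoc)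
  ultimately show ?thesis by simp
qed

text \<open>
  A classical datum is a competitor in the infimum, with the constant sequence as its approximation.
\<close>

lemma observability_constant_le_if_classical_trace:
  assumes S: "wave_semigroup \<theta> S" and U: "U \<in> wave_domain \<theta>" and nz: "state_inner \<theta> U U \<noteq> 0"
    and trace: "\<And>t. t \<in> {0<..<T} \<Longrightarrow> classical_trace S U t = g t" and g: "continuous_on {0..T} g"
  shows "observability_constant \<theta> S T
    \<le> ereal (integral {0..T} (\<lambda>t. (g t)\<^sup>2) / (1 / 2 * state_inner \<theta> U U))"
proof -
  let ?tr = "classical_trace S U"
  have US: "U \<in> state_space \<theta>" using U wave_domain_subset_state_space by blast
  have L2: "?tr \<in> L2 0 T" using trace g by (intro L2_if_continuous[of _ _ g])
  have "state_norm \<theta> (U - U) = 0"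
    by (rule state_norm_zero_if_vanishing) (auto simp: zero_fun_def)
  then have "is_boundary_trace \<theta> S T U ?tr"
    unfolding is_boundary_trace_def using U L2 by (intro conjI exI[of _ "\<lambda>_. U"]) auto
  moreover have "state_norm \<theta> U \<noteq> 0" using nz by (simp add: state_norm_def)
  ultimately have "observability_constant \<theta> S T
      \<le> ereal ((LINT t|lebesgue_on {0<..<T}. (?tr t)\<^sup>2) / energy \<theta> S U 0)"
    unfolding observability_constant_def by (intro Inf_lower) (use US in blast)
  also have "(LINT t|lebesgue_on {0<..<T}. (?tr t)\<^sup>2) = integral {0..T} (\<lambda>t. (g t)\<^sup>2)"
    by (rule integrable_open_interval_if_continuous(2)) (use trace g in \<open>auto intro!: continuous_intros\<close>)
  finally show ?thesis unfolding energy_at_0[OF S US] .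
qed

context degenerate_eigenvalue
begin

definition "\<omega> = (2 - \<theta>) * sqrt c"

definition displacement_mode :: state where "displacement_mode = (\<Phi>, \<lambda>_. 0)"

definition velocity_mode :: state where "velocity_mode = (\<lambda>_. 0, \<Phi>)"

lemma \<omega>: "\<omega> > 0" "\<omega>\<^sup>2 = lam"
  using \<theta> c by (auto simp: \<omega>_def lam_def power_mult_distrib)

lemma modes_mem_wave_domain: "displacement_mode \<in> wave_domain \<theta>" "velocity_mode \<in> wave_domain \<theta>"
  using \<Phi>_mem_H2a \<Phi>_mem_H1a zero_mem_H2a[of \<theta>]
  by (auto simp: displacement_mode_def velocity_mode_def wave_domain_def H2a_def)

lemma modes_mem_state_space: "displacement_mode \<in> state_space \<theta>" "velocity_mode \<in> state_space \<theta>"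
  using modes_mem_wave_domain wave_domain_subset_state_space by auto

lemma wave_operator_modes:
  "(displacement_mode, (- \<omega>\<^sup>2) *\<^sub>R velocity_mode) \<in> wave_operator \<theta>"
  "(velocity_mode, displacement_mode) \<in> wave_operator \<theta>"
proof -
  interpret seminormed_space "state_space \<theta>" "state_norm \<theta>" by (rule seminormed_state_space)
  have self: "state_norm \<theta> (U - U) = 0" for U
    by (rule state_norm_zero_if_vanishing) (auto simp: zero_fun_def)
  have "state_norm \<theta> ((- \<omega>\<^sup>2) *\<^sub>R velocity_mode - wave_map \<theta> displacement_mode) = 0"
    by (rule state_norm_zero_if_vanishing)
      (auto simp: velocity_mode_def displacement_mode_def wave_map_def scaleR_fun_def fun_diff_def
        deriv_powr_deriv_\<Phi> \<omega> zero_fun_def)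
  then show "(displacement_mode, (- \<omega>\<^sup>2) *\<^sub>R velocity_mode) \<in> wave_operator \<theta>"
    unfolding wave_operator_def using modes_mem_wave_domain modes_mem_state_space self scaleR_mem by blast
  have "wave_map \<theta> velocity_mode = displacement_mode"
    by (simp add: wave_map_def velocity_mode_def displacement_mode_def fun_eq_iff)
  then show "(velocity_mode, displacement_mode) \<in> wave_operator \<theta>"
    unfolding wave_operator_def using modes_mem_wave_domain modes_mem_state_space self[of velocity_mode] self[of displacement_mode]
    by (auto intro!: bexI[of _ velocity_mode])
qed

lemma mild_solution_modes:
  assumes S: "wave_semigroup \<theta> S" and "t \<ge> 0" and x: "0 < x" "x \<le> 1"
  shows "mild_solution S (a *\<^sub>R displacement_mode + b *\<^sub>R velocity_mode) t x
    = (a * cos (\<omega> * t) + b / \<omega> * sin (\<omega> * t)) * \<Phi> x"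
proof -
  interpret seminormed_space "state_space \<theta>" "state_norm \<theta>" by (rule seminormed_state_space)
  let ?V = "a *\<^sub>R displacement_mode + b *\<^sub>R velocity_mode"
  let ?U = "(a * cos (\<omega> * t) + b / \<omega> * sin (\<omega> * t)) *\<^sub>R displacement_mode
      + (b * cos (\<omega> * t) - a * \<omega> * sin (\<omega> * t)) *\<^sub>R velocity_mode"
  have contr: "contraction_semigroup (state_space \<theta>) (state_norm \<theta>) S"
    and gen: "semigroup_generator (state_space \<theta>) (state_norm \<theta>) S = wave_operator \<theta>"
    using S by (auto simp: wave_semigroup_def)
  have "state_norm \<theta> (S t ?V - ?U) = 0"
    by (rule semigroup_on_rotation_plane[OF contr \<omega>(1) _ _ \<open>t \<ge> 0\<close>, where a = a and b = b])
      (use wave_operator_modes gen in simp_all)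
  moreover have "S t ?V - ?U \<in> state_space \<theta>"
    using contr \<open>t \<ge> 0\<close> unfolding contraction_semigroup_def
    by (intro diff_mem linear_combination modes_mem_state_space) (auto intro: linear_combination modes_mem_state_space)
  ultimately have "fst (S t ?V - ?U) x = 0"
    using position_zero_if_state_norm_zero x by blast
  then show ?thesis
    by (simp add: mild_solution_def displacement_mode_def velocity_mode_def scaleR_fun_def fun_diff_def)
qed

text \<open>
  Here \<open>flux 1\<close> is \<open>\<Phi>'(1)\<close>, since the weight is \<open>1\<close> at the observed endpoint.
\<close>

lemma classical_trace_modes:
  assumes S: "wave_semigroup \<theta> S" and "t \<ge> 0"
  shows "classical_trace S (a *\<^sub>R displacement_mode + b *\<^sub>R velocity_mode) t
    = (a * cos (\<omega> * t) + b / \<omega> * sin (\<omega> * t)) * flux 1"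
proof -
  let ?u = "mild_solution S (a *\<^sub>R displacement_mode + b *\<^sub>R velocity_mode) t"
  let ?k = "a * cos (\<omega> * t) + b / \<omega> * sin (\<omega> * t)"
  have "((\<lambda>x. ?k * \<Phi> x) has_real_derivative ?k * flux 1) (at 1 within {..<1})"
    using DERIV_cmult[OF DERIV_\<Phi>[of 1], of ?k] by (auto intro: DERIV_subset)
  moreover have "eventually (\<lambda>y. ?k * \<Phi> y = ?u y) (at_left 1)"
    using eventually_at_left_real[of 0 "1::real"]
    by (rule eventually_mono) (use mild_solution_modes[OF S \<open>t \<ge> 0\<close>, of _ a b] in auto)
  moreover have "?k * \<Phi> 1 = ?u 1"
    using mild_solution_modes[OF S \<open>t \<ge> 0\<close>, of 1 a b] by simp
  ultimately have "(?u has_real_derivative ?k * flux 1) (at_left 1)"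
    by (rule has_field_derivative_cong_eventually[THEN iffD1, rotated 2])
  then have "(?u has_vector_derivative ?k * flux 1) (at_left 1)"
    by (simp add: has_real_derivative_iff_has_vector_derivative)
  then show ?thesis
    unfolding classical_trace_def by (rule vector_derivative_within[rotated]) simp
qed

lemma state_inner_modes:
  "state_inner \<theta> displacement_mode displacement_mode = integral {0..1} (\<lambda>x. (\<Phi>w x)\<^sup>2)"
  "state_inner \<theta> velocity_mode velocity_mode = integral {0..1} (\<lambda>x. (\<Phi> x)\<^sup>2)"
proof -
  have "continuous_on {0..1} \<Phi>w" "continuous_on {0..1} \<Phi>"
    using continuous_on_\<Phi> continuous_on_\<Phi>w by (auto intro: continuous_on_subset)
  then show "state_inner \<theta> displacement_mode displacement_mode = integral {0..1} (\<lambda>x. (\<Phi>w x)\<^sup>2)"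
    and "state_inner \<theta> velocity_mode velocity_mode = integral {0..1} (\<lambda>x. (\<Phi> x)\<^sup>2)"
    unfolding state_inner_eq
    by (auto intro!: integrable_open_interval_if_continuous(2) continuous_intros
        simp: displacement_mode_def velocity_mode_def weighted_deriv_\<Phi> weighted_deriv_def[of _ "\<lambda>_. 0"] power2_eq_square)
qed

text \<open>
  With the eigenfunction as initial displacement the quotient is \<open>2 (2 - \<theta>) p\<close>, and with the
  eigenfunction as initial velocity it is \<open>2 (2 - \<theta>) q\<close>, where \<open>p\<close> and \<open>q\<close> are the integrals of
  \<open>cos\<^sup>2 (\<omega> t)\<close> and \<open>sin\<^sup>2 (\<omega> t)\<close> over \<open>[0, T]\<close>.  As \<open>p + q = T\<close>, one of the two quotients is
  at most \<open>(2 - \<theta>) T\<close>.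
\<close>

lemma observability_constant_le:
  assumes S: "wave_semigroup \<theta> S" and "T > 0"
  shows "observability_constant \<theta> S T \<le> ereal ((2 - \<theta>) * T)"
proof -
  define I J where "I = integral {0..1} (\<lambda>x. (\<Phi>w x)\<^sup>2)" and "J = integral {0..1} (\<lambda>x. (\<Phi> x)\<^sup>2)"
  have IJ: "I = lam * J" "(flux 1)\<^sup>2 = (2 - \<theta>) * I" "J > 0" "I > 0"
    using integral_identities lam_pos by (auto simp: I_def J_def)
  define p q where "p = integral {0..T} (\<lambda>t. (cos (\<omega> * t))\<^sup>2)" and "q = integral {0..T} (\<lambda>t. (sin (\<omega> * t))\<^sup>2)"
  have "p + q = integral {0..T} (\<lambda>t. (cos (\<omega> * t))\<^sup>2 + (sin (\<omega> * t))\<^sup>2)"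
    unfolding p_def q_def
    by (rule Henstock_Kurzweil_Integration.integral_add[symmetric])
      (intro integrable_continuous_real continuous_intros)+
  then have pq: "p + q = T" using \<open>T > 0\<close> by simp
  show ?thesis
  proof (cases "p \<le> T / 2")
    case True
    have "observability_constant \<theta> S T
        \<le> ereal (integral {0..T} (\<lambda>t. (cos (\<omega> * t) * flux 1)\<^sup>2) / (1 / 2 * state_inner \<theta> displacement_mode displacement_mode))"
    proof (rule observability_constant_le_if_classical_trace[OF S modes_mem_wave_domain(1)])
      show "state_inner \<theta> displacement_mode displacement_mode \<noteq> 0"
        using IJ(4) by (simp add: state_inner_modes I_def)
      show "classical_trace S displacement_mode t = cos (\<omega> * t) * flux 1" if "t \<in> {0<..<T}" for t
        using classical_trace_modes[OF S, of t 1 0] that by simp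
    qed (intro continuous_intros)
    also have "integral {0..T} (\<lambda>t. (cos (\<omega> * t) * flux 1)\<^sup>2) = (2 - \<theta>) * I * p"
      by (simp add: power_mult_distrib IJ(2) p_def)
    also have "(2 - \<theta>) * I * p / (1 / 2 * state_inner \<theta> displacement_mode displacement_mode) = (2 - \<theta>) * (2 * p)"
      using IJ(4) by (simp add: state_inner_modes I_def[symmetric])
    also have "\<dots> \<le> (2 - \<theta>) * T" using True \<theta> by (intro mult_left_mono) auto
    finally show ?thesis by simp
  next
    case False
    have "observability_constant \<theta> S T
        \<le> ereal (integral {0..T} (\<lambda>t. (sin (\<omega> * t) / \<omega> * flux 1)\<^sup>2) / (1 / 2 * state_inner \<theta> velocity_mode velocity_mode))"
    proof (rule observability_constant_le_if_classical_trace[OF S modes_mem_wave_domain(2)])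
      show "state_inner \<theta> velocity_mode velocity_mode \<noteq> 0"
        using IJ(3) by (simp add: state_inner_modes J_def)
      show "classical_trace S velocity_mode t = sin (\<omega> * t) / \<omega> * flux 1" if "t \<in> {0<..<T}" for t
        using classical_trace_modes[OF S, of t 0 1] that by simp
    qed (use \<omega> in \<open>intro continuous_intros; simp\<close>)
    also have "integral {0..T} (\<lambda>t. (sin (\<omega> * t) / \<omega> * flux 1)\<^sup>2) = (2 - \<theta>) * J * q"
    proof -
      have "(sin (\<omega> * t) / \<omega> * flux 1)\<^sup>2 = (2 - \<theta>) * J * (sin (\<omega> * t))\<^sup>2" for t
        using lam_pos by (simp add: power_mult_distrib power_divide IJ(1,2) \<omega>(2))
      then show ?thesis by (simp add: q_def)
    qed
    also have "(2 - \<theta>) * J * q / (1 / 2 * state_inner \<theta> velocity_mode velocity_mode) = (2 - \<theta>) * (2 * q)"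
      using IJ(3) by (simp add: state_inner_modes J_def[symmetric])
    also have "\<dots> \<le> (2 - \<theta>) * T" using False pq \<theta> by (intro mult_left_mono) auto
    finally show ?thesis by simp
  qed
qed

end

theorem theorem3p10:
  fixes \<theta> T :: real and S :: "real \<Rightarrow> state \<Rightarrow> state"
  assumes "0 < T" and "1 \<le> \<theta>" and "\<theta> < 2"
    and "wave_semigroup \<theta> S"
  shows "observability_constant \<theta> S T \<le> ereal ((2 - \<theta>) * T)"
proof -
  have "1 / (2 - \<theta>) > 0" using assms(3) by simp
  then obtain c where "c > 0" "hyp (1 / (2 - \<theta>)) c = 0"
    by (rule hyp_has_positive_zero)
  then interpret degenerate_eigenvalue \<theta> c
    by unfold_locales (use assms in auto)
  show ?thesis using observability_constant_le assms by blast
qed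

end
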